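(* Let $\mu=(\mu_1,\dots,\mu_l)$ be a partition of $n$ with all parts odd, $l=l(\mu)$. Then the trace $\zeta^{reg}(\mu)$ of $T_{\gamma_\mu}$ in the (left) regular representation of the Hecke-Clifford algebra $\mathcal H^c_n$ is $$\zeta^{reg}(\mu)=2^n(q-1)^{n-l(\mu)}\frac{n!}{\prod_{i}\mu_i!}.$$
   Context: The Hecke-Clifford algebra $\mathcal H^c_n$ is the associative (super)algebra over $\mathbb C(q^{1/2})$ with even generators $T_1,\dots,T_{n-1}$ and odd generators $c_1,\dots,c_n$ subject to: $(T_i-q)(T_i+1)=0$; $T_iT_j=T_jT_i$ for $|i-j|>1$; $T_iT_{i+1}T_i=T_{i+1}T_iT_{i+1}$; $c_i^2=1$, $c_ic_j=-c_jc_i$ ($i\ne j$); $T_ic_j=c_jT_i$ for $j\ne i,i+1$; $T_ic_i=c_{i+1}T_i$. It has a basis $T_\sigma C_I$ ($\sigma\in S_n$, $I\subset\{1,\dots,n\}$), where $T_\sigma$ is the product of the $T_i$ along a reduced expression of $\sigma$ and $C_I$ is the ordered product of the $c_i$, $i\in I$. For a partition $\mu=(\mu_1,\dots,\mu_l)$ of $n$, $\gamma_\mu=\gamma_{\mu_1}\times\cdots\times\gamma_{\mu_l}\in S_{\mu_1}\times\cdots\times S_{\mu_l}\subset S_n$, where $\gamma_k=s_1s_2\cdots s_{k-1}$ is the standard Coxeter element of $S_k$. $\zeta^{reg}(\mu)$ is the trace of the operator of left multiplication by $T_{\gamma_\mu}$ on $\mathcal H^c_n$. *)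

theory Defs
  imports
    "HOL-Algebra.QuotRing"
    "HOL-Library.Poly_Mapping"
    "HOL-Computational_Algebra.Fraction_Field"
    "HOL-Combinatorics.Transposition"
    "Jordan_Normal_Form.VS_Connect"
begin

section \<open>Algebras over a field given by generators and relations\<close>

text \<open>The free unital associative algebra on \<open>X\<close>: finitely supported linear combinations of words
  over \<open>X\<close>, multiplied by concatenating words.\<close>

definition free_algebra :: "'x set \<Rightarrow> ('k::field, 'x list \<Rightarrow>\<^sub>0 'k) module" where
  "free_algebra X =
    \<lparr>carrier = {f. \<forall>w \<in> Poly_Mapping.keys f. set w \<subseteq> X},
     mult = (\<lambda>f g. \<Sum>u \<in> Poly_Mapping.keys f. \<Sum>v \<in> Poly_Mapping.keys g.
       Poly_Mapping.single (u @ v) (Poly_Mapping.lookup f u * Poly_Mapping.lookup g v)),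
     one = Poly_Mapping.single [] 1,
     zero = 0,
     add = (+),
     smult = (\<lambda>k f. Poly_Mapping.map ((*) k) f)\<rparr>"

definition free_gen :: "'x \<Rightarrow> ('x list \<Rightarrow>\<^sub>0 'k::field)" where
  "free_gen x = Poly_Mapping.single [x] 1"

text \<open>The quotient ring \<open>A Quot I\<close> consists of cosets; it lacks a scalar multiplication, which is
  added here in the same style as its product \<^const>\<open>rcoset_mult\<close>.\<close>

definition quotient_algebra :: "('k, 'a) module \<Rightarrow> 'a set \<Rightarrow> ('k, 'a set) module" where
  "quotient_algebra A I =
    \<lparr>carrier = carrier (A Quot I),
     mult = mult (A Quot I),
     one = one (A Quot I),
     zero = zero (A Quot I),
     add = add (A Quot I),
     smult = (\<lambda>k U. \<Union>a \<in> U. I +>\<^bsub>A\<^esub> (k \<odot>\<^bsub>A\<^esub> a))\<rparr>"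

text \<open>A set of relations is a set of pairs (left-hand side, right-hand side); the ideal is two-sided.\<close>

definition relation_ideal ::
    "'x set \<Rightarrow> (('x list \<Rightarrow>\<^sub>0 'k::field) \<times> ('x list \<Rightarrow>\<^sub>0 'k)) set \<Rightarrow> ('x list \<Rightarrow>\<^sub>0 'k) set" where
  "relation_ideal X R = Idl\<^bsub>free_algebra X\<^esub> {l - r | l r. (l, r) \<in> R}"


section \<open>The trace of a linear operator\<close>

definition basis_coord :: "('k::field, 'v, 'm) module_scheme \<Rightarrow> 'v set \<Rightarrow> 'v \<Rightarrow> 'v \<Rightarrow> 'k" where
  "basis_coord V B v = (SOME a. LinearCombinations.module.lincomb V a B = v)"

text \<open>The sum of the diagonal matrix entries in a finite basis. For a linear \<open>f\<close> on a
  finite-dimensional \<open>V\<close> this does not depend on the chosen basis.\<close>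

definition operator_trace :: "('k::field, 'v, 'm) module_scheme \<Rightarrow> ('v \<Rightarrow> 'v) \<Rightarrow> 'k" where
  "operator_trace V f =
    (let B = (SOME B. finite B \<and> VectorSpace.vectorspace.basis class_ring V B)
     in \<Sum>b \<in> B. basis_coord V B (f b) b)"


section \<open>The Hecke-Clifford algebra\<close>

text \<open>The ground field \<open>\<complex>(q\<^sup>1\<^sup>/\<^sup>2)\<close>: rational functions in the indeterminate \<open>q_sqrt\<close>.\<close>

type_synonym hc_field = "complex poly fract"

definition q_sqrt :: hc_field where
  "q_sqrt = Fract [:0, 1:] 1"

definition q :: hc_field where
  "q = q_sqrt ^ 2"

datatype hc_gen = Gen_T nat | Gen_c nat

type_synonym hc_free = "hc_gen list \<Rightarrow>\<^sub>0 hc_field"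

definition hc_gens :: "nat \<Rightarrow> hc_gen set" where
  "hc_gens n = Gen_T ` {1..<n} \<union> Gen_c ` {1..n}"

abbreviation hc_free_algebra :: "nat \<Rightarrow> (hc_field, hc_free) module" (\<open>\<F>\<close>) where
  "\<F> n \<equiv> free_algebra (hc_gens n)"

abbreviation free_T :: "nat \<Rightarrow> hc_free" where
  "free_T i \<equiv> free_gen (Gen_T i)"

abbreviation free_c :: "nat \<Rightarrow> hc_free" where
  "free_c i \<equiv> free_gen (Gen_c i)"

inductive_set hc_relations :: "nat \<Rightarrow> (hc_free \<times> hc_free) set" for n :: nat where
  quadratic: "i \<in> {1..<n} \<Longrightarrow>
    ((free_T i - q \<odot>\<^bsub>\<F> n\<^esub> \<one>\<^bsub>\<F> n\<^esub>) \<otimes>\<^bsub>\<F> n\<^esub> (free_T i + \<one>\<^bsub>\<F> n\<^esub>), 0) \<in> hc_relations n"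
| T_commute: "i \<in> {1..<n} \<Longrightarrow> j \<in> {1..<n} \<Longrightarrow> \<bar>int i - int j\<bar> > 1 \<Longrightarrow>
    (free_T i \<otimes>\<^bsub>\<F> n\<^esub> free_T j, free_T j \<otimes>\<^bsub>\<F> n\<^esub> free_T i) \<in> hc_relations n"
| braid: "i \<in> {1..<n} \<Longrightarrow> i + 1 \<in> {1..<n} \<Longrightarrow>
    (free_T i \<otimes>\<^bsub>\<F> n\<^esub> free_T (i + 1) \<otimes>\<^bsub>\<F> n\<^esub> free_T i,
     free_T (i + 1) \<otimes>\<^bsub>\<F> n\<^esub> free_T i \<otimes>\<^bsub>\<F> n\<^esub> free_T (i + 1)) \<in> hc_relations n"
| c_square: "i \<in> {1..n} \<Longrightarrow> (free_c i \<otimes>\<^bsub>\<F> n\<^esub> free_c i, \<one>\<^bsub>\<F> n\<^esub>) \<in> hc_relations n"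
| c_anticommute: "i \<in> {1..n} \<Longrightarrow> j \<in> {1..n} \<Longrightarrow> i \<noteq> j \<Longrightarrow>
    (free_c i \<otimes>\<^bsub>\<F> n\<^esub> free_c j, - (free_c j \<otimes>\<^bsub>\<F> n\<^esub> free_c i)) \<in> hc_relations n"
| T_c_commute: "i \<in> {1..<n} \<Longrightarrow> j \<in> {1..n} \<Longrightarrow> j \<noteq> i \<Longrightarrow> j \<noteq> i + 1 \<Longrightarrow>
    (free_T i \<otimes>\<^bsub>\<F> n\<^esub> free_c j, free_c j \<otimes>\<^bsub>\<F> n\<^esub> free_T i) \<in> hc_relations n"
| T_c_shift: "i \<in> {1..<n} \<Longrightarrow>
    (free_T i \<otimes>\<^bsub>\<F> n\<^esub> free_c i, free_c (i + 1) \<otimes>\<^bsub>\<F> n\<^esub> free_T i) \<in> hc_relations n"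

definition hc_ideal :: "nat \<Rightarrow> hc_free set" where
  "hc_ideal n = relation_ideal (hc_gens n) (hc_relations n)"

definition hecke_clifford :: "nat \<Rightarrow> (hc_field, hc_free set) module" where
  "hecke_clifford n = quotient_algebra (\<F> n) (hc_ideal n)"

definition hc_T :: "nat \<Rightarrow> nat \<Rightarrow> hc_free set" where
  "hc_T n i = hc_ideal n +>\<^bsub>\<F> n\<^esub> free_T i"


section \<open>The elements \<open>T\<^sub>\<sigma>\<close>\<close>

text \<open>Permutations act on the positions \<open>1, 2, \<dots>\<close>; the product of permutations is composition of
  functions, and \<open>word_perm [i, j, \<dots>]\<close> is \<open>s\<^sub>i s\<^sub>j \<dots>\<close>\<close>

definition word_perm :: "nat list \<Rightarrow> nat \<Rightarrow> nat" where
  "word_perm w = foldr (\<lambda>i \<sigma>. transpose i (i + 1) \<circ> \<sigma>) w id"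

definition reduced_words :: "nat \<Rightarrow> (nat \<Rightarrow> nat) \<Rightarrow> nat list set" where
  "reduced_words n \<sigma> = {w. set w \<subseteq> {1..<n} \<and> word_perm w = \<sigma> \<and>
     (\<forall>v. set v \<subseteq> {1..<n} \<and> word_perm v = \<sigma> \<longrightarrow> length w \<le> length v)}"

text \<open>By the braid relations the result does not depend on the chosen reduced word.\<close>

definition hc_T_perm :: "nat \<Rightarrow> (nat \<Rightarrow> nat) \<Rightarrow> hc_free set" where
  "hc_T_perm n \<sigma> =
    foldr (\<lambda>i x. hc_T n i \<otimes>\<^bsub>hecke_clifford n\<^esub> x) (SOME w. w \<in> reduced_words n \<sigma>)
      \<one>\<^bsub>hecke_clifford n\<^esub>"


section \<open>Partitions and the regular character\<close>

definition is_partition :: "nat \<Rightarrow> nat list \<Rightarrow> bool" where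
  "is_partition n \<mu> \<longleftrightarrow> sorted_wrt (\<ge>) \<mu> \<and> (\<forall>k \<in> set \<mu>. k > 0) \<and> sum_list \<mu> = n"

definition coxeter_perm :: "nat \<Rightarrow> nat \<Rightarrow> nat" where
  "coxeter_perm k = word_perm [1..<k]"

text \<open>\<open>shift_perm k \<sigma>\<close> fixes \<open>1, \<dots>, k\<close> and acts as \<open>\<sigma>\<close> on the positions after \<open>k\<close>.\<close>

definition shift_perm :: "nat \<Rightarrow> (nat \<Rightarrow> nat) \<Rightarrow> nat \<Rightarrow> nat" where
  "shift_perm k \<sigma> x = (if x \<le> k then x else \<sigma> (x - k) + k)"

text \<open>\<open>\<gamma>\<^sub>\<mu> = \<gamma>\<^bsub>\<mu>\<^sub>1\<^esub> \<times> \<dots> \<times> \<gamma>\<^bsub>\<mu>\<^sub>l\<^esub>\<close>, on consecutive blocks of lengths \<open>\<mu>\<^sub>1, \<dots>, \<mu>\<^sub>l\<close>\<close>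

fun gamma_perm :: "nat list \<Rightarrow> nat \<Rightarrow> nat" where
  "gamma_perm [] = id"
| "gamma_perm (k # \<mu>) = coxeter_perm k \<circ> shift_perm k (gamma_perm \<mu>)"

definition zeta_reg :: "nat \<Rightarrow> nat list \<Rightarrow> hc_field" where
  "zeta_reg n \<mu> = operator_trace (hecke_clifford n)
     (\<lambda>x. hc_T_perm n (gamma_perm \<mu>) \<otimes>\<^bsub>hecke_clifford n\<^esub> x)"

end

theory Submission
  imports Defs
begin

text \<open>Left multiplication by \<open>T\<^sub>i\<close> sends \<open>T\<^sub>\<sigma> C\<^sub>I\<close> to \<open>T\<^bsub>s\<^sub>i\<sigma>\<^esub> C\<^sub>I\<close> if \<open>s\<^sub>i\<close> is not a left descent of \<open>\<sigma>\<close>, and to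
  \<open>(q - 1) T\<^sub>\<sigma> C\<^sub>I + q T\<^bsub>s\<^sub>i\<sigma>\<^esub> C\<^sub>I\<close> if it is. In a word \<open>w\<close> with distinct letters a nonempty subword never
  multiplies to the identity, so the diagonal coefficient of \<open>T\<^sub>w\<close> at \<open>T\<^sub>\<sigma> C\<^sub>I\<close> is \<open>(q - 1)\<^bsup>|w|\<^esup>\<close> if all letters
  are left descents of \<open>\<sigma>\<close> and \<open>0\<close> otherwise. The reduced words of \<open>\<gamma>\<^sub>\<mu>\<close> are of this kind, with the \<open>n - l\<close>
  inner positions of the blocks as letters, and \<open>n! / \<Prod> \<mu>\<^sub>i!\<close> permutations have all of these as descents.

  That the elements \<open>T\<^sub>\<sigma> C\<^sub>I\<close> form a basis is seen as follows. They span, because moving \<open>c\<^sub>j\<close> to the right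
  through \<open>T\<^sub>\<sigma>\<close> only produces shorter \<open>T\<^sub>\<tau>\<close>. In the module induced from the regular representation of the
  Hecke algebra, the elements \<open>C\<^sub>I T\<^sub>\<sigma>\<close> map a cyclic vector to \<open>2\<^sup>n n!\<close> different basis vectors up to sign,
  so they are independent and the dimension is at least \<open>2\<^sup>n n!\<close>.\<close>

text \<open>Two families appear because each suits one half of the argument. Applied to the cyclic
  vector, \<open>C_I T_\<sigma>\<close> meets only ascents on empty sites and afterwards single spin
  flips, so no lower terms arise; \<open>T_\<sigma> C_I\<close> would let \<open>T_i\<close> act on
  occupied sites. Left multiplication by \<open>T_i\<close>, however, stays simple on
  \<open>T_\<sigma> C_I\<close>. Comparing cardinality with dimension carries the basis property
  from one family to the other. Two arbitrary choices in the definitions shape the rest. The trace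
  is read off in a chosen basis, so its independence of the basis has to be proved. The element
  attached to \<open>\<gamma>_\<mu>\<close> is a product along a chosen reduced word. Instead of
  relating reduced words by braid moves, the trace is computed for every word with distinct letters;
  it depends only on the set of letters, which all reduced words of \<open>\<gamma>_\<mu>\<close>
  share.\<close>

section \<open>The free algebra as a ring\<close>

text \<open>With concatenation as addition of exponents, the convolution product of
  \<open>poly_mapping\<close> is the product of the free algebra, and its ring type class becomes
  available.\<close>

instantiation list :: (type) monoid_add
begin

definition zero_list :: "'a list" where "zero_list = []"

definition plus_list :: "'a list \<Rightarrow> 'a list \<Rightarrow> 'a list" where "plus_list u v = u @ v"

instance
  by standard (simp_all add: zero_list_def plus_list_def)

end

text \<open>Scalars as central elements: scalar multiplication becomes ring multiplication, so
  linear identities fall to plain ring arithmetic.\<close>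

definition scal :: "'k::field \<Rightarrow> ('x list \<Rightarrow>\<^sub>0 'k)" where
  "scal k = Poly_Mapping.single 0 k"

lemma scal_0 [simp]: "scal 0 = 0"
  and scal_1 [simp]: "scal 1 = 1"
  and scal_add: "scal (a + b) = scal a + scal b"
  and scal_diff: "scal (a - b) = scal a - scal b"
  and scal_minus: "scal (- a) = - scal a"
  and scal_mult: "scal (a * b) = scal a * scal b"
  by (simp_all add: scal_def single_add single_diff single_uminus mult_single)

lemma poly_mapping_single_induct [case_names zero add]:
  assumes "P 0" and "\<And>f w c. P f \<Longrightarrow> P (f + Poly_Mapping.single w c)"
  shows "P (f :: 'a \<Rightarrow>\<^sub>0 'b::comm_monoid_add)"
proof (induction f rule: update_induct)
  case const
  then show ?case by (rule assms(1))
next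
  case (update f w c)
  have "Poly_Mapping.update w c f = f + Poly_Mapping.single w c"
    using update.hyps by (intro poly_mapping_eqI)
      (auto simp: lookup_update lookup_add lookup_single when_def in_keys_iff)
  then show ?case using assms(2)[OF update.IH] by simp
qed

lemma scal_central: "f * scal k = scal k * f"
proof (induction f rule: poly_mapping_single_induct)
  case (add f w c)
  then show ?case by (simp add: distrib_left distrib_right scal_def mult_single mult.commute)
qed simp

lemma scal_left_central: "f * (scal k * g) = scal k * (f * g)"
  by (simp add: scal_central flip: mult.assoc)

lemma free_algebra_simps [simp]:
  "one (free_algebra X) = 1" "zero (free_algebra X) = 0" "add (free_algebra X) = (+)"
  by (simp_all add: free_algebra_def flip: zero_list_def)

lemma free_algebra_smult [simp]: "smult (free_algebra X) k f = scal k * f"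
  by (simp add: free_algebra_def scal_def mult_map_scale_conv_mult)

lemma sum_single_lookup: "(\<Sum>u\<in>Poly_Mapping.keys f. Poly_Mapping.single u (Poly_Mapping.lookup f u)) = f"
proof (rule poly_mapping_eqI)
  fix w
  show "Poly_Mapping.lookup (\<Sum>u\<in>Poly_Mapping.keys f. Poly_Mapping.single u (Poly_Mapping.lookup f u)) w
    = Poly_Mapping.lookup f w"
    by (cases "w \<in> Poly_Mapping.keys f") (simp_all add: lookup_sum lookup_single when_def not_in_keys_iff_lookup_eq_zero)
qed

lemma free_algebra_mult [simp]: "mult (free_algebra X) f g = f * g"
proof -
  have "f * g = (\<Sum>u\<in>Poly_Mapping.keys f. Poly_Mapping.single u (Poly_Mapping.lookup f u)) *
    (\<Sum>v\<in>Poly_Mapping.keys g. Poly_Mapping.single v (Poly_Mapping.lookup g v))"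
    by (simp only: sum_single_lookup)
  also have "\<dots> = f \<otimes>\<^bsub>free_algebra X\<^esub> g"
    by (simp add: free_algebra_def sum_product mult_single plus_list_def)
  finally show ?thesis by simp
qed

lemma free_algebra_carrier_iff:
  "f \<in> carrier (free_algebra X) \<longleftrightarrow> (\<forall>w\<in>Poly_Mapping.keys f. set w \<subseteq> X)"
  by (simp add: free_algebra_def)

lemma free_carrier_single:
  "set w \<subseteq> X \<Longrightarrow> Poly_Mapping.single w k \<in> carrier (free_algebra X)"
  by (simp add: free_algebra_carrier_iff)

lemma free_carrier_add:
  "f \<in> carrier (free_algebra X) \<Longrightarrow> g \<in> carrier (free_algebra X) \<Longrightarrow> f + g \<in> carrier (free_algebra X)"
  using Poly_Mapping.keys_add[of f g] by (auto simp: free_algebra_carrier_iff)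

lemma free_carrier_mult:
  "f \<in> carrier (free_algebra X) \<Longrightarrow> g \<in> carrier (free_algebra X) \<Longrightarrow> f * g \<in> carrier (free_algebra X)"
  using keys_mult[of f g] by (fastforce simp: free_algebra_carrier_iff plus_list_def)

lemma free_carrier_uminus:
  "f \<in> carrier (free_algebra X) \<Longrightarrow> - f \<in> carrier (free_algebra X)"
  by (simp add: free_algebra_carrier_iff)

lemma free_carrier_diff:
  "f \<in> carrier (free_algebra X) \<Longrightarrow> g \<in> carrier (free_algebra X) \<Longrightarrow> f - g \<in> carrier (free_algebra X)"
  using free_carrier_add[of f X "- g"] by (simp add: free_carrier_uminus)

lemma free_carrier_scal: "scal k \<in> carrier (free_algebra X)"
  by (simp add: free_algebra_carrier_iff scal_def zero_list_def)

lemma free_carrier_0: "0 \<in> carrier (free_algebra X)"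
  and free_carrier_1: "1 \<in> carrier (free_algebra X)"
  using free_carrier_scal[of 0] free_carrier_scal[of 1] by simp_all

lemma free_carrier_sum:
  "(\<And>i. i \<in> S \<Longrightarrow> f i \<in> carrier (free_algebra X)) \<Longrightarrow> sum f S \<in> carrier (free_algebra X)"
  by (induction S rule: infinite_finite_induct) (auto simp: free_carrier_0 free_carrier_add)

lemma free_carrier_gen: "x \<in> X \<Longrightarrow> free_gen x \<in> carrier (free_algebra X)"
  by (simp add: free_gen_def free_carrier_single)

lemmas free_carrier = free_carrier_add free_carrier_mult free_carrier_uminus free_carrier_diff
  free_carrier_scal free_carrier_0 free_carrier_1 free_carrier_sum free_carrier_gen

lemma ring_free_algebra: "ring (free_algebra X)"
proof (rule ringI)
  show "abelian_group (free_algebra X)"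
    by (rule abelian_groupI)
      (auto simp: free_carrier algebra_simps intro: bexI[OF _ free_carrier_uminus])
  show "Group.monoid (free_algebra X)"
    by (rule monoidI) (auto simp: free_carrier algebra_simps)
qed (auto simp: algebra_simps)

lemma free_a_inv:
  assumes "f \<in> carrier (free_algebra X)"
  shows "a_inv (free_algebra X) f = - f"
proof -
  interpret ring "free_algebra X" by (rule ring_free_algebra)
  show ?thesis
    using assms add.inv_equality[of "- f" f] by (simp add: a_inv_def free_carrier)
qed

lemma free_ideal_diff:
  assumes "ideal I (free_algebra X)" "f \<in> I" "g \<in> I"
  shows "f - g \<in> I"
proof -
  interpret ideal I "free_algebra X" by fact
  have "f \<oplus>\<^bsub>free_algebra X\<^esub> (\<ominus>\<^bsub>free_algebra X\<^esub> g) \<in> I"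
    using assms by (simp del: free_algebra_simps)
  then show ?thesis using assms Icarr by (simp add: free_a_inv)
qed

section \<open>The defining relations as congruences in the free algebra\<close>

lemma carrier_T: "i \<in> {1..<n} \<Longrightarrow> free_T i \<in> carrier (\<F> n)"
  and carrier_c: "j \<in> {1..n} \<Longrightarrow> free_c j \<in> carrier (\<F> n)"
  by (auto intro!: free_carrier_gen simp: hc_gens_def)

lemma hc_relations_carrier:
  "(l, r) \<in> hc_relations n \<Longrightarrow> l \<in> carrier (\<F> n) \<and> r \<in> carrier (\<F> n)"
  by (induction rule: hc_relations.induct) (auto simp: free_carrier carrier_T carrier_c)

lemma ideal_hc_ideal: "ideal (hc_ideal n) (\<F> n)"
  unfolding hc_ideal_def relation_ideal_def
  by (rule ring.genideal_ideal[OF ring_free_algebra])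
    (auto dest!: hc_relations_carrier intro: free_carrier)

text \<open>Calculations are carried out on representatives modulo the ideal; cosets enter only when
  the vector space structure is needed.\<close>

definition hc_eq :: "nat \<Rightarrow> hc_free \<Rightarrow> hc_free \<Rightarrow> bool" where
  "hc_eq n x y \<longleftrightarrow> x - y \<in> hc_ideal n"

lemma hc_relation_eq:
  assumes "(l, r) \<in> hc_relations n"
  shows "hc_eq n l r"
proof -
  have "{l - r | l r. (l, r) \<in> hc_relations n} \<subseteq> hc_ideal n"
    unfolding hc_ideal_def relation_ideal_def
    by (rule ring.genideal_self[OF ring_free_algebra])
      (auto dest!: hc_relations_carrier intro: free_carrier)
  then show ?thesis using assms unfolding hc_eq_def by blast
qed

lemma hc_ideal_0: "0 \<in> hc_ideal n"
proof -
  interpret ideal "hc_ideal n" "\<F> n" by (rule ideal_hc_ideal)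
  show ?thesis using additive_subgroup.zero_closed[OF is_additive_subgroup] by simp
qed

lemma hc_ideal_add: "x \<in> hc_ideal n \<Longrightarrow> y \<in> hc_ideal n \<Longrightarrow> x + y \<in> hc_ideal n"
proof -
  interpret ideal "hc_ideal n" "\<F> n" by (rule ideal_hc_ideal)
  show "x \<in> hc_ideal n \<Longrightarrow> y \<in> hc_ideal n \<Longrightarrow> x + y \<in> hc_ideal n" 
    using additive_subgroup.a_closed[OF is_additive_subgroup] by simp
qed

lemma hc_ideal_mult_left: "x \<in> hc_ideal n \<Longrightarrow> y \<in> carrier (\<F> n) \<Longrightarrow> y * x \<in> hc_ideal n"
  and hc_ideal_mult_right: "x \<in> hc_ideal n \<Longrightarrow> y \<in> carrier (\<F> n) \<Longrightarrow> x * y \<in> hc_ideal n"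
proof -
  interpret ideal "hc_ideal n" "\<F> n" by (rule ideal_hc_ideal)
  show "x \<in> hc_ideal n \<Longrightarrow> y \<in> carrier (\<F> n) \<Longrightarrow> y * x \<in> hc_ideal n"
    and "x \<in> hc_ideal n \<Longrightarrow> y \<in> carrier (\<F> n) \<Longrightarrow> x * y \<in> hc_ideal n"
    using I_l_closed I_r_closed by simp_all
qed

lemma hc_ideal_diff: "x \<in> hc_ideal n \<Longrightarrow> y \<in> hc_ideal n \<Longrightarrow> x - y \<in> hc_ideal n"
  by (rule free_ideal_diff[OF ideal_hc_ideal])

lemma hc_eq_refl [simp]: "hc_eq n x x"
  by (simp add: hc_eq_def hc_ideal_0)

lemma hc_eq_sym: "hc_eq n x y \<Longrightarrow> hc_eq n y x"
  using hc_ideal_diff[OF hc_ideal_0, of "x - y" n] by (simp add: hc_eq_def)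

lemma hc_eq_trans [trans]: "hc_eq n x y \<Longrightarrow> hc_eq n y z \<Longrightarrow> hc_eq n x z"
  using hc_ideal_add[of "x - y" n "y - z"] by (simp add: hc_eq_def)

lemma hc_eq_add: "hc_eq n x y \<Longrightarrow> hc_eq n x' y' \<Longrightarrow> hc_eq n (x + x') (y + y')"
  using hc_ideal_add[of "x - y" n "x' - y'"] by (simp add: hc_eq_def algebra_simps)

lemma hc_eq_sum: "(\<And>i. i \<in> S \<Longrightarrow> hc_eq n (f i) (g i)) \<Longrightarrow> hc_eq n (sum f S) (sum g S)"
  by (induction S rule: infinite_finite_induct) (auto intro: hc_eq_add)

lemma hc_eq_mult_left: "hc_eq n x y \<Longrightarrow> z \<in> carrier (\<F> n) \<Longrightarrow> hc_eq n (z * x) (z * y)"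
  using hc_ideal_mult_left[of "x - y" n z] by (simp add: hc_eq_def algebra_simps)

lemma hc_eq_mult_right: "hc_eq n x y \<Longrightarrow> z \<in> carrier (\<F> n) \<Longrightarrow> hc_eq n (x * z) (y * z)"
  using hc_ideal_mult_right[of "x - y" n z] by (simp add: hc_eq_def algebra_simps)

lemma hc_eq_scal: "hc_eq n x y \<Longrightarrow> hc_eq n (scal k * x) (scal k * y)"
  by (rule hc_eq_mult_left) (auto intro: free_carrier)

lemma q_nonzero: "q \<noteq> 0"
proof -
  have "q_sqrt \<noteq> 0"
    unfolding q_sqrt_def Zero_fract_def by (subst eq_fract) simp_all
  then show ?thesis by (simp add: q_def)
qed

lemma T_square:
  assumes "i \<in> {1..<n}"
  shows "hc_eq n (free_T i * free_T i) (scal (q - 1) * free_T i + scal q)"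
  using hc_relation_eq[OF hc_relations.quadratic[OF assms]]
  by (simp add: hc_eq_def algebra_simps free_a_inv free_carrier carrier_T scal_diff)

lemma T_T_commute:
  assumes "i \<in> {1..<n}" "j \<in> {1..<n}" "i + 1 < j \<or> j + 1 < i"
  shows "hc_eq n (free_T i * free_T j) (free_T j * free_T i)"
  using hc_relation_eq[OF hc_relations.T_commute[of i n j]] assms by auto

lemma T_braid:
  assumes "i \<in> {1..<n}" "i + 1 \<in> {1..<n}"
  shows "hc_eq n (free_T i * free_T (i + 1) * free_T i) (free_T (i + 1) * free_T i * free_T (i + 1))"
  using hc_relation_eq[OF hc_relations.braid[of i n]] assms by simp

lemma c_c_one: "i \<in> {1..n} \<Longrightarrow> hc_eq n (free_c i * free_c i) 1"
  using hc_relation_eq[OF hc_relations.c_square[of i n]] by simp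

lemma c_c_anticommute:
  assumes "i \<in> {1..n}" "j \<in> {1..n}" "i \<noteq> j"
  shows "hc_eq n (free_c i * free_c j) (- (free_c j * free_c i))"
  using hc_relation_eq[OF hc_relations.c_anticommute[of i n j]] assms by simp

lemma c_T_commute:
  assumes "i \<in> {1..<n}" "j \<in> {1..n}" "j \<noteq> i" "j \<noteq> i + 1"
  shows "hc_eq n (free_c j * free_T i) (free_T i * free_c j)"
  using hc_relation_eq[OF hc_relations.T_c_commute[of i n j]] assms by (simp add: hc_eq_sym)

lemma c_Suc_T:
  assumes "i \<in> {1..<n}"
  shows "hc_eq n (free_c (i + 1) * free_T i) (free_T i * free_c i)"
  using hc_relation_eq[OF hc_relations.T_c_shift[of i n]] assms by (simp add: hc_eq_sym)

text \<open>Conjugating \<open>c\<^sub>i\<^sub>+\<^sub>1 T\<^sub>i = T\<^sub>i c\<^sub>i\<close> by \<open>T\<^sub>i\<close> gives \<open>q\<close> times the claim, up to the quadratic relation.\<close>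

lemma c_T:
  assumes i: "i \<in> {1..<n}"
  shows "hc_eq n (free_c i * free_T i)
    (free_T i * free_c (i + 1) + scal (q - 1) * (free_c i - free_c (i + 1)))"
proof -
  let ?T = "free_T i :: hc_free" and ?c = "free_c i :: hc_free" and ?d = "free_c (Suc i) :: hc_free"
  have car [simp]: "?T \<in> carrier (\<F> n)" "?c \<in> carrier (\<F> n)" "?d \<in> carrier (\<F> n)"
    using i by (auto intro: carrier_T carrier_c)
  define S where "S = ?T * ?T - (scal (q - 1) * ?T + scal q)"
  define R where "R = ?d * ?T - ?T * ?c"
  have S: "S \<in> hc_ideal n" using T_square[OF i] by (simp add: hc_eq_def S_def)
  have R: "R \<in> hc_ideal n" using c_Suc_T[OF i] by (simp add: hc_eq_def R_def)
  define a p :: hc_free where "a = scal (q - 1)" and "p = scal q"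
  have com: "?T * a = a * ?T" "?c * a = a * ?c" "?d * a = a * ?d" "?T * p = p * ?T" "?c * p = p * ?c"
      "?d * p = p * ?d" "p * a = a * p"
    unfolding a_def p_def by (rule scal_central)+
  have com': "x * y = y * x \<Longrightarrow> x * (y * z) = y * (x * z)" for x y z :: hc_free
    by (simp flip: mult.assoc)
  let ?X = "?c * ?T - (?T * ?d + a * (?c - ?d))"
  \<comment> \<open>In the first three terms the words of length four cancel, which leaves
    \<open>p * (?c * ?T - ?T * ?d)\<close> and the error
    \<open>a * (?T * ?c * ?T - ?T * ?d * ?T)\<close>. The five terms with factor \<open>a\<close>
    replace this error by \<open>- p * a * (?c - ?d)\<close>.\<close>
  have "p * ?X = ?T * ?d * S - S * ?c * ?T - ?T * R * ?T + a * (R * ?T)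
     + a * S * ?c - a * (?d * S) + a * (?T * R) - a * (a * R)"
    by (simp add: S_def R_def algebra_simps com com[THEN com'] flip: a_def p_def)
  moreover have "\<dots> \<in> hc_ideal n"
    unfolding a_def
    by (intro hc_ideal_add hc_ideal_diff S R hc_ideal_mult_left hc_ideal_mult_right free_carrier car)
  ultimately have "p * ?X \<in> hc_ideal n"
    by (rule ssubst)
  from hc_ideal_mult_left[OF this free_carrier_scal[of "inverse q"]]
  have "scal (inverse q) * (p * ?X) \<in> hc_ideal n" .
  moreover have "scal (inverse q) * (p * ?X) = ?X"
    using q_nonzero unfolding p_def mult.assoc[symmetric] scal_mult[symmetric] by simp
  ultimately show ?thesis
    unfolding hc_eq_def a_def by simp
qed

section \<open>The elements \<open>T\<^sub>\<sigma>\<close>\<close>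

abbreviation swap :: "nat \<Rightarrow> nat \<Rightarrow> nat" where
  "swap i \<equiv> transpose i (Suc i)"

text \<open>A substitute for the number of inversions: earlier positions weigh more, so undoing a
  descent lowers the sum. Only two summands change, which makes the comparison immediate.\<close>

definition swap_weight :: "nat \<Rightarrow> (nat \<Rightarrow> nat) \<Rightarrow> nat" where
  "swap_weight n f = (\<Sum>k\<in>{1..n}. (n - k) * f k)"

lemma swap_weight_less:
  assumes i: "i \<in> {1..<n}" and "f (Suc i) < f i"
  shows "swap_weight n (f \<circ> swap i) < swap_weight n f"
proof -
  let ?R = "{1..n} - {i, Suc i}"
  have split: "swap_weight n g = (n - i) * g i + ((n - (Suc i)) * g (Suc i) + (\<Sum>k\<in>?R. (n - k) * g k))" for g
  proof -
    have "{1..n} = insert i (insert (Suc i) ?R)" using i by auto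
    then have "swap_weight n g = (\<Sum>k\<in>insert i (insert (Suc i) ?R). (n - k) * g k)"
      by (simp only: swap_weight_def)
    then show ?thesis by simp
  qed
  have rest: "(\<Sum>k\<in>?R. (n - k) * (f \<circ> swap i) k) = (\<Sum>k\<in>?R. (n - k) * f k)"
    by (intro sum.cong) (auto simp: transpose_def)
  obtain d where d: "n - i = Suc d" "n - (Suc i) = d"
    using i by (metis Suc_diff_Suc atLeastLessThan_iff)
  show ?thesis
    unfolding split[of f] split[of "f \<circ> swap i"] rest d using assms(2) by simp
qed

text \<open>A permutation \<open>\<sigma>\<close> is represented by \<open>f = \<sigma>\<^sup>-\<^sup>1\<close>: then \<open>s\<^sub>i \<sigma>\<close> becomes \<open>f \<circ> swap i\<close>, and \<open>s\<^sub>i\<close> is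
  a left descent of \<open>\<sigma>\<close> iff \<open>f (Suc i) < f i\<close>. Accordingly \<open>T_elem n f\<close> is \<open>T\<^sub>\<sigma>\<close>.\<close>

definition some_descent :: "nat \<Rightarrow> (nat \<Rightarrow> nat) \<Rightarrow> nat" where
  "some_descent n f = (SOME i. i \<in> {1..<n} \<and> f (Suc i) < f i)"

function T_elem :: "nat \<Rightarrow> (nat \<Rightarrow> nat) \<Rightarrow> hc_free" where
  "T_elem n f =
    (if \<exists>i\<in>{1..<n}. f (Suc i) < f i
     then free_T (some_descent n f) * T_elem n (f \<circ> swap (some_descent n f)) else 1)"
  by auto

lemma some_descent:
  assumes "i \<in> {1..<n}" "f (Suc i) < f i"
  shows "some_descent n f \<in> {1..<n}" "f (Suc (some_descent n f)) < f (some_descent n f)"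
  using someI[of "\<lambda>i. i \<in> {1..<n} \<and> f (Suc i) < f i" i] assms
  by (auto simp: some_descent_def)

termination T_elem
proof (relation "measure (\<lambda>(n, f). swap_weight n f)")
  fix n and f :: "nat \<Rightarrow> nat"
  assume "\<exists>i\<in>{1..<n}. f (Suc i) < f i"
  then obtain i where "i \<in> {1..<n}" "f (Suc i) < f i" by blast
  from swap_weight_less[OF some_descent[OF this]]
  show "((n, f \<circ> swap (some_descent n f)), n, f) \<in> measure (\<lambda>(n, f). swap_weight n f)"
    by simp
qed simp

declare T_elem.simps [simp del]

lemma T_elem_carrier: "T_elem n f \<in> carrier (\<F> n)"
proof (induction n f rule: T_elem.induct)
  case (1 n f)
  show ?case
  proof (cases "\<exists>i\<in>{1..<n}. f (Suc i) < f i")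
    case True
    then obtain i where "i \<in> {1..<n}" "f (Suc i) < f i" by blast
    from some_descent[OF this] have "free_T (some_descent n f) \<in> carrier (\<F> n)"
      by (intro carrier_T)
    with 1[OF True] show ?thesis
      using True by (subst T_elem.simps) (simp only: if_True free_carrier_mult)
  qed (subst T_elem.simps, auto intro: free_carrier)
qed

lemma swap_swap [simp]: "f \<circ> swap i \<circ> swap i = f"
  by (simp add: comp_assoc)

lemma swap_commute: "Suc i < j \<or> Suc j < i \<Longrightarrow> f \<circ> swap i \<circ> swap j = f \<circ> swap j \<circ> swap i"
  by (auto simp: fun_eq_iff transpose_def)

lemma swap_braid: "f \<circ> swap i \<circ> swap (Suc i) \<circ> swap i = f \<circ> swap (Suc i) \<circ> swap i \<circ> swap (Suc i)"
  by (auto simp: fun_eq_iff transpose_def)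

lemma T_elem_some_descent:
  assumes "i \<in> {1..<n}" "f (Suc i) < f i"
  shows "T_elem n f = free_T (some_descent n f) * T_elem n (f \<circ> swap (some_descent n f))"
  using assms by (subst T_elem.simps) auto

text \<open>Independence of the chosen descent, by a diamond argument: two descents \<open>i\<close>
  and \<open>j\<close> of \<open>f\<close> can be continued to a common shorter element, along the
  commutation relation if they are far apart and along the braid relation if they are adjacent.
  Induction on the weight covers the continuations.\<close>

lemma T_elem_descent:
  assumes "i \<in> {1..<n}" "f (Suc i) < f i"
  shows "hc_eq n (T_elem n f) (free_T i * T_elem n (f \<circ> swap i))"
  using assms
proof (induction "swap_weight n f" arbitrary: f i rule: less_induct)
  case less
  let ?D = "\<lambda>f i. i \<in> {1..<n} \<and> f (Suc i) < (f i :: nat)"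
  let ?b = "T_elem n"
  \<comment> \<open>The induction hypothesis behind a prefix \<open>x\<close>, so that letters can
    be split off one after another.\<close>
  have IH: "hc_eq n (x * ?b g) (x * free_T k * ?b (g \<circ> swap k))"
    if "swap_weight n g < swap_weight n f" "?D g k" "x \<in> carrier (\<F> n)" for g k x
    using hc_eq_mult_left[OF less.hyps[OF that(1)] that(3), of k] that(2) by (simp add: mult.assoc)
  have w: "swap_weight n (g \<circ> swap k) < swap_weight n f"
    if "?D g k" "g = f \<or> swap_weight n g < swap_weight n f" for g k
    using swap_weight_less[of k n g] that by auto
  have far: "hc_eq n (free_T i * ?b (f \<circ> swap i)) (free_T j * ?b (f \<circ> swap j))"
    if i: "?D f i" and j: "?D f j" and ij: "Suc i < j \<or> Suc j < i" for i j
  proof -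
    have ij': "?D (f \<circ> swap i) j" "?D (f \<circ> swap j) i"
      using i j ij by (auto simp: transpose_def)
    have T: "free_T i \<in> carrier (\<F> n)" "free_T j \<in> carrier (\<F> n)"
      using i j by (auto intro: carrier_T)
    have "hc_eq n (free_T i * ?b (f \<circ> swap i)) (free_T i * free_T j * ?b (f \<circ> swap i \<circ> swap j))"
      by (rule IH[OF w[OF i] ij'(1) T(1)]) simp
    also have "hc_eq n \<dots> (free_T j * free_T i * ?b (f \<circ> swap j \<circ> swap i))"
      unfolding swap_commute[OF ij]
      using T_T_commute[of i n j] i j ij by (intro hc_eq_mult_right T_elem_carrier) auto
    also have "hc_eq n \<dots> (free_T j * ?b (f \<circ> swap j))"
      by (rule hc_eq_sym, rule IH[OF w[OF j] ij'(2) T(2)]) simp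
    finally show ?thesis .
  qed
  have near: "hc_eq n (free_T i * ?b (f \<circ> swap i)) (free_T j * ?b (f \<circ> swap j))"
    if i: "?D f i" and j: "?D f j" and ij: "j = Suc i" for i j
  proof -
    \<comment> \<open>Here \<open>f\<close> is strictly decreasing on three consecutive positions;
      both ways of reversing them run through descents only.\<close>
    have i1: "?D (f \<circ> swap i) j" and i2: "?D (f \<circ> swap i \<circ> swap j) i"
      and j1: "?D (f \<circ> swap j) i" and j2: "?D (f \<circ> swap j \<circ> swap i) j"
      using i j ij by (auto simp: transpose_def)
    have T: "free_T i \<in> carrier (\<F> n)" "free_T j \<in> carrier (\<F> n)"
      using i j by (auto intro: carrier_T)
    have "hc_eq n (free_T i * ?b (f \<circ> swap i)) (free_T i * free_T j * ?b (f \<circ> swap i \<circ> swap j))"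
      by (rule IH[OF w[OF i] i1 T(1)]) simp
    also have "hc_eq n \<dots> (free_T i * free_T j * free_T i * ?b (f \<circ> swap i \<circ> swap j \<circ> swap i))"
      by (rule IH[OF w[OF i1 disjI2[OF w[OF i]]] i2 free_carrier_mult[OF T]]) simp
    also have "hc_eq n \<dots> (free_T j * free_T i * free_T j * ?b (f \<circ> swap j \<circ> swap i \<circ> swap j))"
      using T_braid[of i n] i j ij swap_braid[of f i]
      by (simp only: ij) (intro hc_eq_mult_right T_elem_carrier, simp)
    also have "hc_eq n \<dots> (free_T j * free_T i * ?b (f \<circ> swap j \<circ> swap i))"
      by (rule hc_eq_sym, rule IH[OF w[OF j1 disjI2[OF w[OF j]]] j2 free_carrier_mult[OF T(2) T(1)]]) simp
    also have "hc_eq n \<dots> (free_T j * ?b (f \<circ> swap j))"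
      by (rule hc_eq_sym, rule IH[OF w[OF j] j1 T(2)]) simp
    finally show ?thesis .
  qed
  define j where "j = some_descent n f"
  have i: "?D f i" and j: "?D f j"
    using some_descent[OF less.prems] less.prems by (simp_all add: j_def)
  have "hc_eq n (free_T j * ?b (f \<circ> swap j)) (free_T i * ?b (f \<circ> swap i))"
  proof -
    consider "i = j" | "Suc i < j \<or> Suc j < i" | "j = Suc i" | "i = Suc j" by linarith
    then show ?thesis
    proof cases
      case 2
      then show ?thesis using far[OF j i] by blast
    next
      case 3
      then show ?thesis by (intro hc_eq_sym[OF near[OF i j]])
    next
      case 4
      then show ?thesis by (intro near[OF j i])
    qed simp
  qed
  then show ?case
    using T_elem_some_descent[of i n f] i by (simp add: j_def)
qed

lemma T_T_elem_ascent:
  assumes "i \<in> {1..<n}" "f i < f (Suc i)"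
  shows "hc_eq n (free_T i * T_elem n f) (T_elem n (f \<circ> swap i))"
  using T_elem_descent[of i n "f \<circ> swap i"] assms by (simp add: hc_eq_sym)

lemma T_T_elem_descent:
  assumes "i \<in> {1..<n}" "f (Suc i) < f i"
  shows "hc_eq n (free_T i * T_elem n f) (scal (q - 1) * T_elem n f + scal q * T_elem n (f \<circ> swap i))"
proof -
  let ?b = "T_elem n"
  have T: "free_T i \<in> carrier (\<F> n)" using assms by (auto intro: carrier_T)
  note d = T_elem_descent[of i n f, OF assms]
  have "hc_eq n (free_T i * ?b f) (free_T i * free_T i * ?b (f \<circ> swap i))"
    using hc_eq_mult_left[OF d T] by (simp add: mult.assoc)
  also have "hc_eq n \<dots> ((scal (q - 1) * free_T i + scal q) * ?b (f \<circ> swap i))"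
    by (intro hc_eq_mult_right T_square T_elem_carrier assms)
  also have "\<dots> = scal (q - 1) * (free_T i * ?b (f \<circ> swap i)) + scal q * ?b (f \<circ> swap i)"
    by (simp add: distrib_right mult.assoc)
  also have "hc_eq n \<dots> (scal (q - 1) * ?b f + scal q * ?b (f \<circ> swap i))"
    by (intro hc_eq_add hc_eq_refl hc_eq_scal hc_eq_sym[OF d])
  finally show ?thesis .
qed

lemma T_elem_id: "T_elem n id = 1"
  by (subst T_elem.simps) auto

section \<open>The spanning set \<open>T\<^sub>\<sigma> C\<^sub>I\<close>\<close>

declare upt_Suc [simp del]

text \<open>The list of positions is a parameter so that the ordered product can be cut at the
  position where a new generator enters.\<close>

definition clifford_prod :: "nat set \<Rightarrow> nat list \<Rightarrow> hc_free" where
  "clifford_prod I ks = prod_list (map (\<lambda>k. if k \<in> I then free_c k else 1) ks)"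

definition C_elem :: "nat \<Rightarrow> nat set \<Rightarrow> hc_free" where
  "C_elem n I = clifford_prod I [1..<Suc n]"

lemma clifford_prod_simps [simp]:
  "clifford_prod I [] = 1"
  "clifford_prod I (k # ks) = (if k \<in> I then free_c k * clifford_prod I ks else clifford_prod I ks)"
  "clifford_prod I (ks @ ls) = clifford_prod I ks * clifford_prod I ls"
  by (simp_all add: clifford_prod_def)

lemma clifford_prod_carrier: "set ks \<subseteq> {1..n} \<Longrightarrow> clifford_prod I ks \<in> carrier (\<F> n)"
  by (induction ks) (auto intro!: free_carrier_mult free_carrier_1 carrier_c)

lemma clifford_prod_cong:
  "(\<And>k. k \<in> set ks \<Longrightarrow> k \<in> I \<longleftrightarrow> k \<in> I') \<Longrightarrow> clifford_prod I ks = clifford_prod I' ks"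
  by (induction ks) auto

lemma C_elem_empty: "C_elem n {} = 1"
proof -
  have "clifford_prod {} ks = 1" for ks by (induction ks) auto
  then show ?thesis unfolding C_elem_def .
qed

lemma c_clifford_prod_commute:
  assumes "set ks \<subseteq> {1..n}" "j \<in> {1..n}" "j \<notin> set ks"
  shows "\<exists>e\<in>{1, -1}. hc_eq n (free_c j * clifford_prod I ks) (scal e * (clifford_prod I ks * free_c j))"
  using assms
proof (induction ks)
  case Nil
  then show ?case by (auto intro: bexI[of _ 1])
next
  case (Cons k ks)
  have "set ks \<subseteq> {1..n}" "j \<notin> set ks" using Cons.prems by auto
  from Cons.IH[OF this(1) Cons.prems(2) this(2)] obtain e where e: "e \<in> {1, -1}"
    and IH: "hc_eq n (free_c j * clifford_prod I ks) (scal e * (clifford_prod I ks * free_c j))"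
    by blast
  show ?case
  proof (cases "k \<in> I")
    case True
    have k: "k \<in> {1..n}" "k \<noteq> j" using Cons.prems by auto
    have "hc_eq n (free_c j * free_c k * clifford_prod I ks) (- (free_c k * free_c j) * clifford_prod I ks)"
      using Cons.prems k by (intro hc_eq_mult_right c_c_anticommute clifford_prod_carrier) auto
    also have "\<dots> = scal (-1) * (free_c k * (free_c j * clifford_prod I ks))"
      by (simp add: scal_minus mult.assoc)
    also have "hc_eq n \<dots> (scal (-1) * (free_c k * (scal e * (clifford_prod I ks * free_c j))))"
      using IH k by (intro hc_eq_scal hc_eq_mult_left carrier_c) auto
    also have "\<dots> = scal (- e) * (free_c k * clifford_prod I ks * free_c j)"
      using scal_left_central[of "free_c k" e "clifford_prod I ks * free_c j"]
      by (simp add: scal_minus mult.assoc)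
    finally show ?thesis
      using True e by (intro bexI[of _ "- e"]) (auto simp: mult.assoc)
  qed (use IH e in auto)
qed

definition toggle :: "'a \<Rightarrow> 'a set \<Rightarrow> 'a set" where
  "toggle j I = (if j \<in> I then I - {j} else insert j I)"

text \<open>The generator passes the factors before position \<open>j\<close> at the cost of a sign;
  at \<open>j\<close> it either is inserted or cancels against its own copy.\<close>

lemma c_C_elem:
  assumes j: "j \<in> {1..n}"
  shows "\<exists>e\<in>{1, -1}. hc_eq n (free_c j * C_elem n I) (scal e * C_elem n (toggle j I))"
proof -
  let ?A = "clifford_prod I [1..<j]" and ?B = "clifford_prod I [Suc j..<Suc n]"
  let ?J = "toggle j I"
  have list: "[1..<Suc n] = [1..<j] @ j # [Suc j..<Suc n]"
    using j upt_add_eq_append[of 1 j "Suc n - j"] by (simp add: upt_conv_Cons)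
  have sub: "set [1..<j] \<subseteq> {1..n}" "j \<notin> set [1..<j]" "set [Suc j..<Suc n] \<subseteq> {1..n}"
    using j by auto
  have same: "clifford_prod ?J [1..<j] = ?A" "clifford_prod ?J [Suc j..<Suc n] = ?B"
    using j by (intro clifford_prod_cong; auto simp: toggle_def)+
  note car = clifford_prod_carrier[OF sub(1)] clifford_prod_carrier[OF sub(3)]
  obtain e where e: "e \<in> {1, -1}" and A: "hc_eq n (free_c j * ?A) (scal e * (?A * free_c j))"
    using c_clifford_prod_commute[OF sub(1) j sub(2)] by blast
  \<comment> \<open>The factors at position \<open>j\<close> before and after the
    multiplication.\<close>
  define x y :: hc_free where "x = (if j \<in> I then free_c j else 1)" and "y = (if j \<in> I then 1 else free_c j)"
  have xy: "hc_eq n (free_c j * x) y"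
    using c_c_one[OF j] by (simp add: x_def y_def)
  have x: "x \<in> carrier (\<F> n)" using j by (auto simp: x_def intro: free_carrier carrier_c)
  have "C_elem n I = ?A * x * ?B"
    unfolding C_elem_def list x_def by (simp add: mult.assoc)
  then have "free_c j * C_elem n I = free_c j * ?A * (x * ?B)" by (simp add: mult.assoc)
  also have "hc_eq n \<dots> (scal e * (?A * free_c j) * (x * ?B))"
    using A x by (intro hc_eq_mult_right free_carrier_mult car) auto
  also have "\<dots> = scal e * (?A * (free_c j * x * ?B))" by (simp add: mult.assoc)
  also have "hc_eq n \<dots> (scal e * (?A * (y * ?B)))"
    by (intro hc_eq_scal hc_eq_mult_left hc_eq_mult_right xy car)
  also have "?A * (y * ?B) = C_elem n ?J"
    unfolding C_elem_def list clifford_prod_simps same by (simp add: y_def toggle_def)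
  finally show ?thesis using e by blast
qed

definition hc_index :: "nat \<Rightarrow> ((nat \<Rightarrow> nat) \<times> nat set) set" where
  "hc_index n = {f. f permutes {1..n}} \<times> Pow {1..n}"

definition TC_elem :: "nat \<Rightarrow> (nat \<Rightarrow> nat) \<times> nat set \<Rightarrow> hc_free" where
  "TC_elem n p = T_elem n (fst p) * C_elem n (snd p)"

text \<open>The family that acts simply on configurations; it serves only to bound the dimension
  from below.\<close>

definition CT_elem :: "nat \<Rightarrow> (nat \<Rightarrow> nat) \<times> nat set \<Rightarrow> hc_free" where
  "CT_elem n p = C_elem n (snd p) * T_elem n (fst p)"

lemma C_elem_carrier: "C_elem n I \<in> carrier (\<F> n)"
  unfolding C_elem_def by (rule clifford_prod_carrier) auto

lemma TC_elem_carrier: "TC_elem n p \<in> carrier (\<F> n)"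
  and CT_elem_carrier: "CT_elem n p \<in> carrier (\<F> n)"
  by (simp_all only: TC_elem_def CT_elem_def free_carrier_mult T_elem_carrier C_elem_carrier)

lemma finite_hc_index: "finite (hc_index n)"
  by (simp add: hc_index_def finite_permutations)

definition TC_span :: "nat \<Rightarrow> hc_free set" where
  "TC_span n = {x. \<exists>k. hc_eq n x (\<Sum>p\<in>hc_index n. scal (k p) * TC_elem n p)}"

lemma TC_spanI: "hc_eq n x (\<Sum>p\<in>hc_index n. scal (k p) * TC_elem n p) \<Longrightarrow> x \<in> TC_span n"
  unfolding TC_span_def by blast

lemma TC_span_eq: "hc_eq n x y \<Longrightarrow> y \<in> TC_span n \<Longrightarrow> x \<in> TC_span n"
  by (auto simp: TC_span_def intro: hc_eq_trans)

lemma TC_span_add: "x \<in> TC_span n \<Longrightarrow> y \<in> TC_span n \<Longrightarrow> x + y \<in> TC_span n"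
proof -
  assume "x \<in> TC_span n" "y \<in> TC_span n"
  then obtain k l where "hc_eq n x (\<Sum>p\<in>hc_index n. scal (k p) * TC_elem n p)"
    "hc_eq n y (\<Sum>p\<in>hc_index n. scal (l p) * TC_elem n p)"
    by (auto simp: TC_span_def)
  from hc_eq_add[OF this]
  have "hc_eq n (x + y) (\<Sum>p\<in>hc_index n. scal (k p + l p) * TC_elem n p)"
    by (simp add: scal_add distrib_right sum.distrib)
  then show ?thesis by (rule TC_spanI)
qed

lemma TC_span_scal: "x \<in> TC_span n \<Longrightarrow> scal a * x \<in> TC_span n"
proof -
  assume "x \<in> TC_span n"
  then obtain k where "hc_eq n x (\<Sum>p\<in>hc_index n. scal (k p) * TC_elem n p)"
    by (auto simp: TC_span_def)
  from hc_eq_scal[OF this, of a]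
  have "hc_eq n (scal a * x) (\<Sum>p\<in>hc_index n. scal (a * k p) * TC_elem n p)"
    by (simp add: scal_mult sum_distrib_left mult.assoc)
  then show ?thesis by (rule TC_spanI)
qed

lemma TC_span_0: "0 \<in> TC_span n"
  by (rule TC_spanI[of _ _ "\<lambda>_. 0"]) simp

lemma TC_span_diff: "x \<in> TC_span n \<Longrightarrow> y \<in> TC_span n \<Longrightarrow> x - y \<in> TC_span n"
  using TC_span_add[of x n "scal (-1) * y"] TC_span_scal[of y n "-1"] by (simp add: scal_minus)

lemma TC_span_sum: "(\<And>i. i \<in> S \<Longrightarrow> f i \<in> TC_span n) \<Longrightarrow> sum f S \<in> TC_span n"
  by (induction S rule: infinite_finite_induct) (auto intro: TC_span_0 TC_span_add)

lemma TC_span_elem: "p \<in> hc_index n \<Longrightarrow> TC_elem n p \<in> TC_span n"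
proof -
  assume "p \<in> hc_index n"
  then have "(\<Sum>r\<in>hc_index n. scal (if r = p then 1 else 0) * TC_elem n r) = TC_elem n p"
    by (simp add: if_distrib[of scal] if_distrib[of "\<lambda>x. x * _"] finite_hc_index sum.delta' cong: if_cong)
  then show ?thesis
    by (intro TC_spanI[of _ _ "\<lambda>r. if r = p then 1 else 0"]) simp
qed

lemma TC_span_mult_left:
  assumes z: "z \<in> carrier (\<F> n)" and gen: "\<And>p. p \<in> hc_index n \<Longrightarrow> z * TC_elem n p \<in> TC_span n"
    and x: "x \<in> TC_span n"
  shows "z * x \<in> TC_span n"
proof -
  obtain k where "hc_eq n x (\<Sum>p\<in>hc_index n. scal (k p) * TC_elem n p)"
    using x by (auto simp: TC_span_def)
  from hc_eq_mult_left[OF this z]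
  have "hc_eq n (z * x) (\<Sum>p\<in>hc_index n. scal (k p) * (z * TC_elem n p))"
    by (simp add: sum_distrib_left scal_left_central)
  then show ?thesis
    by (rule TC_span_eq) (intro TC_span_sum TC_span_scal gen)
qed

lemma permutes_comp_swap:
  assumes "f permutes {1..n}" "i \<in> {1..<n}"
  shows "f \<circ> swap i permutes {1..n}"
  using assms by (intro permutes_compose permutes_swap_id) auto

lemma permutes_ascent_or_descent:
  assumes "f permutes {1..n}"
  shows "f i < f (Suc i) \<or> f (Suc i) < f i"
  using permutes_inj[OF assms] by (metis inj_eq linorder_neqE_nat n_not_Suc_n)

lemma TC_span_T:
  assumes i: "i \<in> {1..<n}" and x: "x \<in> TC_span n"
  shows "free_T i * x \<in> TC_span n"
proof (rule TC_span_mult_left[OF carrier_T[OF i] _ x])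
  fix p assume p: "p \<in> hc_index n"
  obtain f I where fI: "p = (f, I)" by (cases p)
  have f: "f permutes {1..n}" and I: "I \<subseteq> {1..n}" using p fI by (auto simp: hc_index_def)
  have p': "(f \<circ> swap i, I) \<in> hc_index n"
    using permutes_comp_swap[OF f i] I by (simp add: hc_index_def)
  show "free_T i * TC_elem n p \<in> TC_span n"
  proof (cases "f i < f (Suc i)")
    case True
    from hc_eq_mult_right[OF T_T_elem_ascent[OF i True] C_elem_carrier]
    have "hc_eq n (free_T i * TC_elem n p) (TC_elem n (f \<circ> swap i, I))"
      by (simp only: TC_elem_def fI fst_conv snd_conv mult.assoc)
    then show ?thesis by (rule TC_span_eq[OF _ TC_span_elem[OF p']])
  next
    case False
    then have desc: "f (Suc i) < f i" using permutes_ascent_or_descent[OF f] by blast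
    from hc_eq_mult_right[OF T_T_elem_descent[OF i desc] C_elem_carrier]
    have "hc_eq n (free_T i * TC_elem n p)
        (scal (q - 1) * TC_elem n p + scal q * TC_elem n (f \<circ> swap i, I))"
      by (simp only: TC_elem_def fst_conv snd_conv distrib_right mult.assoc fI)
    then show ?thesis
      by (rule TC_span_eq) (intro TC_span_add TC_span_scal TC_span_elem p p')
  qed
qed

text \<open>Split off a letter \<open>T_i\<close> at a descent. Each relation for
  \<open>c_j T_i\<close> leaves some \<open>c_k\<close> in front of the shorter element, possibly
  followed by \<open>T_i\<close> on the left. The induction hypothesis handles the former and
  \<open>TC_span_T\<close> the latter.\<close>

lemma TC_span_c_elem:
  assumes "f permutes {1..n}" "I \<subseteq> {1..n}" "j \<in> {1..n}"
  shows "free_c j * TC_elem n (f, I) \<in> TC_span n"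
  using assms
proof (induction "swap_weight n f" arbitrary: f j rule: less_induct)
  case less
  note f = less.prems(1) and j = less.prems(3)
  have [simp]: "free_c j \<in> carrier (\<F> n)" if "j \<in> {1..n}" for j using that by (rule carrier_c)
  show ?case
  proof (cases "\<exists>i\<in>{1..<n}. f (Suc i) < f i")
    case False
    then have "TC_elem n (f, I) = C_elem n I"
      by (subst TC_elem_def, subst T_elem.simps) auto
    moreover obtain e where "hc_eq n (free_c j * C_elem n I) (scal e * C_elem n (toggle j I))"
      using c_C_elem[OF j] by blast
    moreover have "(id, toggle j I) \<in> hc_index n"
      using less.prems by (auto simp: hc_index_def toggle_def permutes_id)
    then have "C_elem n (toggle j I) \<in> TC_span n"
      using TC_span_elem[of "(id, toggle j I)" n] by (simp add: TC_elem_def T_elem_id)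
    ultimately show ?thesis
      by (metis TC_span_eq TC_span_scal)
  next
    case True
    then obtain i where i: "i \<in> {1..<n}" "f (Suc i) < f i" by blast
    let ?p = "(f \<circ> swap i, I)"
    note T = carrier_T[OF i(1)]
    have IH: "free_c k * TC_elem n ?p \<in> TC_span n" if "k \<in> {1..n}" for k
      using less.hyps[OF swap_weight_less[OF i] permutes_comp_swap[OF f i(1)] less.prems(2) that] .
    have TIH: "free_T i * (free_c k * TC_elem n ?p) \<in> TC_span n" if "k \<in> {1..n}" for k
      by (rule TC_span_T[OF i(1) IH[OF that]])
    have i': "i \<in> {1..n}" "Suc i \<in> {1..n}" using i by auto
    have "hc_eq n (free_c j * TC_elem n (f, I)) (free_c j * (free_T i * TC_elem n ?p))"
      using hc_eq_mult_left[OF hc_eq_mult_right[OF T_elem_descent[OF i] C_elem_carrier] carrier_c[OF j]]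
      by (simp only: TC_elem_def fst_conv snd_conv mult.assoc)
    moreover have "free_c j * (free_T i * TC_elem n ?p) \<in> TC_span n"
    proof -
      have *: "free_c j * (free_T i * TC_elem n ?p) \<in> TC_span n"
        if "hc_eq n (free_c j * free_T i) y" "y * TC_elem n ?p \<in> TC_span n" for y
        using hc_eq_mult_right[OF that(1) TC_elem_carrier] that(2)
        by (metis TC_span_eq mult.assoc)
      consider "j = i" | "j = Suc i" | "j \<noteq> i" "j \<noteq> Suc i" by blast
      then show ?thesis
      proof cases
        case 1
        have "(free_T i * free_c (i + 1) + scal (q - 1) * (free_c i - free_c (i + 1))) * TC_elem n ?p
          = free_T i * (free_c (Suc i) * TC_elem n ?p) +
            scal (q - 1) * (free_c i * TC_elem n ?p - free_c (Suc i) * TC_elem n ?p)"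
          by (simp add: distrib_right left_diff_distrib mult.assoc)
        also have "\<dots> \<in> TC_span n"
          by (intro TC_span_add TC_span_scal TC_span_diff TIH IH i')
        finally show ?thesis
          using *[of "free_T i * free_c (i + 1) + scal (q - 1) * (free_c i - free_c (i + 1))"]
            c_T[OF i(1)] 1 by blast
      next
        case 2
        then show ?thesis
          using *[of "free_T i * free_c i"] c_Suc_T[OF i(1)] TIH[OF i'(1)] by (simp add: mult.assoc)
      next
        case 3
        then show ?thesis
          using *[OF c_T_commute[OF i(1) j]] TIH[OF j] by (simp add: mult.assoc)
      qed
    qed
    ultimately show ?thesis by (rule TC_span_eq)
  qed
qed

text \<open>The span contains \<open>1\<close> and is stable under left multiplication by all
  generators, hence contains every word.\<close>

lemma TC_span_carrier:
  assumes "x \<in> carrier (\<F> n)"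
  shows "x \<in> TC_span n"
proof -
  have one: "1 \<in> TC_span n"
    using TC_span_elem[of "(id, {})" n]
    by (simp add: TC_elem_def T_elem_id C_elem_empty hc_index_def permutes_id)
  have word: "Poly_Mapping.single w 1 \<in> TC_span n" if "set w \<subseteq> hc_gens n" for w
    using that
  proof (induction w)
    case Nil
    then show ?case using one by (simp flip: zero_list_def)
  next
    case (Cons g w)
    have "Poly_Mapping.single (g # w) 1 = free_gen g * Poly_Mapping.single w (1 :: hc_field)"
      by (simp add: free_gen_def mult_single plus_list_def)
    moreover consider i where "i \<in> {1..<n}" "g = Gen_T i" | j where "j \<in> {1..n}" "g = Gen_c j"
      using Cons.prems by (auto simp: hc_gens_def)
    then have "free_gen g * Poly_Mapping.single w 1 \<in> TC_span n"
    proof cases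
      case 1
      then show ?thesis using TC_span_T Cons by auto
    next
      case 2
      have "free_c j * TC_elem n p \<in> TC_span n" if "p \<in> hc_index n" for p
        using that TC_span_c_elem[of "fst p" n "snd p" j] 2 by (auto simp: hc_index_def)
      then show ?thesis using TC_span_mult_left[OF carrier_c] 2 Cons by auto
    qed
    ultimately show ?case by simp
  qed
  have "x = (\<Sum>w\<in>Poly_Mapping.keys x. scal (Poly_Mapping.lookup x w) * Poly_Mapping.single w 1)"
    using sum_single_lookup[of x] by (simp add: scal_def mult_single)
  moreover have "\<dots> \<in> TC_span n"
    using assms by (intro TC_span_sum TC_span_scal word) (auto simp: free_algebra_carrier_iff)
  ultimately show ?thesis by simp
qed

section \<open>A representation on functions of spin configurations\<close>

type_synonym site = "bool \<times> nat"

text \<open>The module has basis \<open>C\<^sub>I \<otimes> T\<^sub>\<sigma>\<close>, encoded by the configuration \<open>k \<mapsto> (k \<in> I, \<sigma>\<^sup>-\<^sup>1 k)\<close>. On the sites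
  \<open>i\<close> and \<open>i + 1\<close> the relations force \<open>T (1 \<otimes> v) = 1 \<otimes> T v\<close>, \<open>T (c\<^sub>i \<otimes> v) = c\<^sub>i\<^sub>+\<^sub>1 \<otimes> T v\<close>,
  \<open>T (c\<^sub>i\<^sub>+\<^sub>1 \<otimes> v) = c\<^sub>i \<otimes> T v + (q - 1) (c\<^sub>i\<^sub>+\<^sub>1 - c\<^sub>i) \<otimes> v\<close> and
  \<open>T (c\<^sub>i c\<^sub>i\<^sub>+\<^sub>1 \<otimes> v) = - c\<^sub>i c\<^sub>i\<^sub>+\<^sub>1 \<otimes> T v + (q - 1) (1 + c\<^sub>i c\<^sub>i\<^sub>+\<^sub>1) \<otimes> v\<close>; \<open>hecke_site\<close> and \<open>T_site\<close> give the
  coefficients of the result. The case \<open>x = y\<close> does not occur for permutations, but keeps the relations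
  valid for all configurations.\<close>

definition hecke_site :: "(nat \<Rightarrow> nat \<Rightarrow> hc_field) \<Rightarrow> nat \<Rightarrow> nat \<Rightarrow> hc_field" where
  "hecke_site u x y =
    (if x = y then q * u x x else if y < x then u y x + (q - 1) * u x y else q * u y x)"

definition T_site :: "(site \<Rightarrow> site \<Rightarrow> hc_field) \<Rightarrow> site \<Rightarrow> site \<Rightarrow> hc_field" where
  "T_site u s t =
    (let H = (\<lambda>b c. hecke_site (\<lambda>x y. u (b, x) (c, y)) (snd s) (snd t));
         U = (\<lambda>b c. u (b, snd s) (c, snd t))
     in if fst s then
          (if fst t then - H True True + (q - 1) * U True True
           else H False True - (q - 1) * U False True)
        else
          (if fst t then H True False + (q - 1) * U False True
           else H False False + (q - 1) * U True True))"

lemma T_site_simps: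
  "T_site u (True, x) (True, y) =
    - hecke_site (\<lambda>x y. u (True, x) (True, y)) x y + (q - 1) * u (True, x) (True, y)"
  "T_site u (True, x) (False, y) =
    hecke_site (\<lambda>x y. u (False, x) (True, y)) x y - (q - 1) * u (False, x) (True, y)"
  "T_site u (False, x) (True, y) =
    hecke_site (\<lambda>x y. u (True, x) (False, y)) x y + (q - 1) * u (False, x) (True, y)"
  "T_site u (False, x) (False, y) =
    hecke_site (\<lambda>x y. u (False, x) (False, y)) x y + (q - 1) * u (True, x) (True, y)"
  by (simp_all add: T_site_def)

lemma T_site_linear: "T_site (\<lambda>s t. a * u s t + b * v s t) s t = a * T_site u s t + b * T_site v s t"
  by (cases s; cases t; cases "fst s"; cases "fst t")
    (auto simp: T_site_simps hecke_site_def algebra_simps)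

lemma T_site_square: "T_site (T_site u) s t = (q - 1) * T_site u s t + q * u s t"
  by (cases s; cases t; cases "fst s"; cases "fst t"; cases "snd s" "snd t" rule: linorder_cases)
    (auto simp: T_site_simps hecke_site_def algebra_simps)

text \<open>The two operators act on disjoint pairs of arguments; this is the local form of
  \<open>T_i T_j = T_j T_i\<close>.\<close>

lemma T_site_commute:
  "T_site (\<lambda>s t. T_site (\<lambda>s' t'. u s t s' t') x y) z w = T_site (\<lambda>s' t'. T_site (\<lambda>s t. u s t s' t') z w) x y"
  by (cases x; cases y; cases z; cases w; cases "fst x"; cases "fst y"; cases "fst z"; cases "fst w";
      cases "snd x" "snd y" rule: linorder_cases; cases "snd z" "snd w" rule: linorder_cases)
    (simp_all add: T_site_simps hecke_site_def algebra_simps)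

definition T_site12 :: "(site \<Rightarrow> site \<Rightarrow> site \<Rightarrow> hc_field) \<Rightarrow> site \<Rightarrow> site \<Rightarrow> site \<Rightarrow> hc_field" where
  "T_site12 u s t r = T_site (\<lambda>s t. u s t r) s t"

definition T_site23 :: "(site \<Rightarrow> site \<Rightarrow> site \<Rightarrow> hc_field) \<Rightarrow> site \<Rightarrow> site \<Rightarrow> site \<Rightarrow> hc_field" where
  "T_site23 u s t r = T_site (\<lambda>t r. u s t r) t r"

lemma T_site_braid:
  "T_site12 (T_site23 (T_site12 u)) s t r = T_site23 (T_site12 (T_site23 u)) s t r"
proof -
  obtain b x c y d z where [simp]: "s = (b, x)" "t = (c, y)" "r = (d, z)"
    by (cases s; cases t; cases r)
  have H: "hecke_site u x y = q * u y x" "hecke_site u y x = u x y + (q - 1) * u y x" if "x < y" for u x y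
    using that by (simp_all add: hecke_site_def)
  have E: "hecke_site u x x = q * u x x" for u x
    by (simp add: hecke_site_def)
  note defs = T_site12_def T_site23_def T_site_simps
  note defs = T_site12_def T_site23_def T_site_simps \<open>s = (b, x)\<close> \<open>t = (c, y)\<close> \<open>r = (d, z)\<close>
  \<comment> \<open>For three distinct values the identity holds with \<open>a\<close> and
    \<open>q\<close> as independent parameters. Where values coincide, \<open>E\<close> has the
    eigenvalue \<open>q\<close> and the relation \<open>q = a + 1\<close> enters.\<close>
  define a where "a = q - 1"
  have qa: "q = a + 1" by (simp add: a_def)
  \<comment> \<open>The thirteen cases are the weak orderings of three numbers; each is checked for
    all eight spin patterns.\<close>
  have c1: ?thesis if "x < y" "y < z" "x < z"
    by (cases b; cases c; cases d; simp only: defs H[OF that(1)] H[OF that(2)] H[OF that(3)] flip: a_def; simp add: algebra_simps)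
  have c2: ?thesis if "x < z" "z < y" "x < y"
    by (cases b; cases c; cases d; simp only: defs H[OF that(1)] H[OF that(2)] H[OF that(3)] flip: a_def; simp add: algebra_simps)
  have c3: ?thesis if "y < x" "x < z" "y < z"
    by (cases b; cases c; cases d; simp only: defs H[OF that(1)] H[OF that(2)] H[OF that(3)] flip: a_def; simp add: algebra_simps)
  have c4: ?thesis if "y < z" "z < x" "y < x"
    by (cases b; cases c; cases d; simp only: defs H[OF that(1)] H[OF that(2)] H[OF that(3)] flip: a_def; simp add: algebra_simps)
  have c5: ?thesis if "z < x" "x < y" "z < y"
    by (cases b; cases c; cases d; simp only: defs H[OF that(1)] H[OF that(2)] H[OF that(3)] flip: a_def; simp add: algebra_simps)
  have c6: ?thesis if "z < y" "y < x" "z < x"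
    by (cases b; cases c; cases d; simp only: defs H[OF that(1)] H[OF that(2)] H[OF that(3)] flip: a_def; simp add: algebra_simps)
  have c7: ?thesis if "x = y" "y < z"
    by (cases b; cases c; cases d; simp only: defs that(1) E H[OF that(2)] H[OF that(2)[unfolded that(1)]] flip: a_def; simp add: qa algebra_simps)
  have c8: ?thesis if "x = y" "z < y"
    by (cases b; cases c; cases d; simp only: defs that(1) E H[OF that(2)] H[OF that(2)[unfolded that(1)]] flip: a_def; simp add: qa algebra_simps)
  have c9: ?thesis if "y = z" "x < y"
    by (cases b; cases c; cases d; simp only: defs that(1) E H[OF that(2)] H[OF that(2)[unfolded that(1)]] flip: a_def; simp add: qa algebra_simps)
  have c10: ?thesis if "y = z" "y < x"
    by (cases b; cases c; cases d; simp only: defs that(1) E H[OF that(2)] H[OF that(2)[unfolded that(1)]] flip: a_def; simp add: qa algebra_simps)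
  have c11: ?thesis if "x = z" "x < y"
    by (cases b; cases c; cases d; simp only: defs that(1) E H[OF that(2)] H[OF that(2)[unfolded that(1)]] flip: a_def; simp add: qa algebra_simps)
  have c12: ?thesis if "x = z" "y < x"
    by (cases b; cases c; cases d; simp only: defs that(1) E H[OF that(2)] H[OF that(2)[unfolded that(1)]] flip: a_def; simp add: qa algebra_simps)
  have c13: ?thesis if "x = y" "y = z"
    by (cases b; cases c; cases d; simp only: defs that E flip: a_def; simp add: qa algebra_simps)
  show ?thesis
    using less_linear[of x y] less_linear[of y z] less_linear[of x z] less_trans[of x y z] less_trans[of z y x]
    by (elim disjE) (rule c1 c2 c3 c4 c5 c6 c7 c8 c9 c10 c11 c12 c13; (assumption | blast))+
qed

type_synonym config = "nat \<Rightarrow> site"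

definition T_op :: "nat \<Rightarrow> (config \<Rightarrow> hc_field) \<Rightarrow> config \<Rightarrow> hc_field" where
  "T_op i \<phi> p = T_site (\<lambda>s t. \<phi> (p(i := s, Suc i := t))) (p i) (p (Suc i))"

definition site_sign :: "site \<Rightarrow> hc_field" where
  "site_sign s = (if fst s then -1 else 1)"

text \<open>The Jordan-Wigner form of the Clifford generators: a spin flip at \<open>j\<close> with
  the parity of the occupied sites before \<open>j\<close> as sign.\<close>

definition c_op :: "nat \<Rightarrow> (config \<Rightarrow> hc_field) \<Rightarrow> config \<Rightarrow> hc_field" where
  "c_op j \<phi> p = (\<Prod>k\<in>{1..<j}. site_sign (p k)) * \<phi> (p(j := (\<not> fst (p j), snd (p j))))"

lemma T_op_linear: "T_op i (\<lambda>p. a * \<phi> p + b * \<psi> p) p = a * T_op i \<phi> p + b * T_op i \<psi> p"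
  by (simp add: T_op_def T_site_linear)

lemma c_op_linear: "c_op j (\<lambda>p. a * \<phi> p + b * \<psi> p) p = a * c_op j \<phi> p + b * c_op j \<psi> p"
  by (simp add: c_op_def algebra_simps)

lemma T_op_square: "T_op i (T_op i \<phi>) p = (q - 1) * T_op i \<phi> p + q * \<phi> p"
  by (simp add: T_op_def T_site_square fun_upd_twist)

lemma T_op_commute:
  assumes "Suc i < j"
  shows "T_op i (T_op j \<phi>) p = T_op j (T_op i \<phi>) p"
proof -
  have "p(i := s, Suc i := t, j := s', Suc j := t') = p(j := s', Suc j := t', i := s, Suc i := t)" for s t s' t'
    using assms by (auto simp: fun_eq_iff)
  moreover have "(p(i := s, Suc i := t)) j = p j" "(p(i := s, Suc i := t)) (Suc j) = p (Suc j)"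
      "(p(j := s, Suc j := t)) i = p i" "(p(j := s, Suc j := t)) (Suc i) = p (Suc i)" for s t
    using assms by simp_all
  ultimately show ?thesis
    unfolding T_op_def by (simp only:) (rule T_site_commute)
qed

lemma T_op_braid: "T_op i (T_op (Suc i) (T_op i \<phi>)) p = T_op (Suc i) (T_op i (T_op (Suc i) \<phi>)) p"
proof -
  let ?p = "\<lambda>s t r. p(i := s, Suc i := t, Suc (Suc i) := r)"
  have 12: "T_op i \<psi> (?p s t r) = T_site12 (\<lambda>s t r. \<psi> (?p s t r)) s t r" for \<psi> s t r
    by (simp add: T_op_def T_site12_def fun_upd_twist[of "Suc (Suc i)"])
  have 23: "T_op (Suc i) \<psi> (?p s t r) = T_site23 (\<lambda>s t r. \<psi> (?p s t r)) s t r" for \<psi> s t r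
    by (simp add: T_op_def T_site23_def)
  have "p = ?p (p i) (p (Suc i)) (p (Suc (Suc i)))" by simp
  then show ?thesis
    using T_site_braid by (metis (no_types, lifting) 12 23 ext)
qed

lemma site_sign_square [simp]: "site_sign s * site_sign s = 1"
  by (simp add: site_sign_def)

lemma c_op_square: "c_op j (c_op j \<phi>) p = \<phi> p"
proof -
  let ?P = "\<lambda>p. \<Prod>k\<in>{1..<j}. site_sign (p k)"
  have "?P (p(j := s)) = ?P p" for s by (rule prod.cong) auto
  moreover have "?P p * ?P p = 1"
    by (simp flip: prod.distrib)
  ultimately show ?thesis
    by (simp add: c_op_def flip: mult.assoc)
qed

text \<open>The flip at \<open>i\<close> changes exactly one factor in the sign of
  \<open>c_j\<close>, whereas the sign of \<open>c_i\<close> does not see the flip at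
  \<open>j\<close>.\<close>

lemma c_op_anticommute_less:
  assumes "i < j" "1 \<le> i"
  shows "c_op i (c_op j \<phi>) p = - c_op j (c_op i \<phi>) p"
proof -
  let ?s = "(\<not> fst (p i), snd (p i))" and ?t = "(\<not> fst (p j), snd (p j))"
  have "(\<Prod>k\<in>{1..<j}. site_sign ((p(i := ?s)) k)) =
      site_sign ?s * (\<Prod>k\<in>{1..<j} - {i}. site_sign ((p(i := ?s)) k))"
    using assms by (subst prod.remove[of _ i]) auto
  also have "(\<Prod>k\<in>{1..<j} - {i}. site_sign ((p(i := ?s)) k)) = (\<Prod>k\<in>{1..<j} - {i}. site_sign (p k))"
    by (rule prod.cong) auto
  also have "site_sign ?s * \<dots> = - (site_sign (p i) * \<dots>)"
    by (simp add: site_sign_def)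
  also have "site_sign (p i) * (\<Prod>k\<in>{1..<j} - {i}. site_sign (p k)) = (\<Prod>k\<in>{1..<j}. site_sign (p k))"
    using assms by (subst prod.remove[of _ i, symmetric]) auto
  finally have 1: "(\<Prod>k\<in>{1..<j}. site_sign ((p(i := ?s)) k)) = - (\<Prod>k\<in>{1..<j}. site_sign (p k))" .
  have 2: "(\<Prod>k\<in>{1..<i}. site_sign ((p(j := ?t)) k)) = (\<Prod>k\<in>{1..<i}. site_sign (p k))"
    using assms by (intro prod.cong) auto
  show ?thesis
    unfolding c_op_def 1 2 using assms by (simp add: fun_upd_twist[of i j])
qed

lemma c_op_anticommute:
  "i \<noteq> j \<Longrightarrow> 1 \<le> i \<Longrightarrow> 1 \<le> j \<Longrightarrow> c_op i (c_op j \<phi>) p = - c_op j (c_op i \<phi>) p"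
  by (cases "i < j") (simp_all add: c_op_anticommute_less)

lemma T_site_scale: "T_site (\<lambda>s t. a * u s t) s t = a * T_site u s t"
  using T_site_linear[of a u 0] by simp

text \<open>\<open>T_site\<close> mixes only spin patterns of equal parity on its two sites.
  Therefore \<open>T_i\<close> commutes with the sign of \<open>c_j\<close> when both sites lie
  before \<open>j\<close>.\<close>

lemma T_site_sign:
  "T_site (\<lambda>s t. site_sign s * (site_sign t * u s t)) s t = site_sign s * (site_sign t * T_site u s t)"
  by (cases s; cases t; cases "fst s"; cases "fst t")
    (auto simp: T_site_simps hecke_site_def site_sign_def algebra_simps)

lemma T_c_op_commute:
  assumes "1 \<le> i" "j \<noteq> i" "j \<noteq> Suc i"
  shows "T_op i (c_op j \<phi>) p = c_op j (T_op i \<phi>) p"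
proof -
  let ?u = "(\<not> fst (p j), snd (p j))"
  have tw: "p(i := s, Suc i := t, j := ?u) = p(j := ?u, i := s, Suc i := t)" for s t
    using assms by (auto simp: fun_eq_iff)
  show ?thesis
  proof (cases "j < i")
    case True
    then have "(\<Prod>k\<in>{1..<j}. site_sign ((p(i := s, Suc i := t)) k)) = (\<Prod>k\<in>{1..<j}. site_sign (p k))" for s t
      by (intro prod.cong) auto
    then show ?thesis
      unfolding T_op_def c_op_def using assms True by (simp add: T_site_scale tw)
  next
    case False
    then have j: "Suc i < j" using assms by simp
    define c where "c = (\<Prod>k\<in>{1..<j} - {i} - {Suc i}. site_sign (p k))"
    have split: "(\<Prod>k\<in>{1..<j}. g k) = g i * (g (Suc i) * (\<Prod>k\<in>{1..<j} - {i} - {Suc i}. g k))"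
      for g :: "nat \<Rightarrow> hc_field"
    proof -
      have "(\<Prod>k\<in>{1..<j}. g k) = g i * (\<Prod>k\<in>{1..<j} - {i}. g k)"
        using assms j by (intro prod.remove) auto
      also have "(\<Prod>k\<in>{1..<j} - {i}. g k) = g (Suc i) * (\<Prod>k\<in>{1..<j} - {i} - {Suc i}. g k)"
        using assms j by (intro prod.remove) auto
      finally show ?thesis .
    qed
    have "(\<Prod>k\<in>{1..<j}. site_sign ((p(i := s, Suc i := t)) k)) = site_sign s * (site_sign t * c)" for s t
    proof -
      have "(\<Prod>k\<in>{1..<j} - {i} - {Suc i}. site_sign ((p(i := s, Suc i := t)) k)) = c"
        unfolding c_def by (intro prod.cong) auto
      then show ?thesis
        unfolding split by simp
    qed
    note sgn = this
    have "(\<Prod>k\<in>{1..<j}. site_sign (p k)) = site_sign (p i) * (site_sign (p (Suc i)) * c)"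
      using sgn[of "p i" "p (Suc i)"] by simp
    then have "c_op j (T_op i \<phi>) p =
        site_sign (p i) * (site_sign (p (Suc i)) * (c * T_op i \<phi> (p(j := ?u))))"
      by (simp add: c_op_def mult.assoc)
    moreover have "T_op i (c_op j \<phi>) p =
        T_site (\<lambda>s t. site_sign s * (site_sign t * (c * \<phi> (p(j := ?u, i := s, Suc i := t))))) (p i) (p (Suc i))"
      unfolding T_op_def c_op_def sgn using assms by (simp add: tw mult.assoc)
    ultimately show ?thesis
      using assms by (simp add: T_site_sign T_site_scale T_op_def)
  qed
qed

lemma T_c_op_shift:
  assumes "1 \<le> i"
  shows "T_op i (c_op i \<phi>) p = c_op (Suc i) (T_op i \<phi>) p"
proof -
  let ?u = "\<lambda>s. (\<not> fst s, snd s)"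
  have P: "(\<Prod>k\<in>{1..<i}. site_sign ((p(i := s, Suc i := t)) k)) = (\<Prod>k\<in>{1..<i}. site_sign (p k))" for s t
    by (intro prod.cong) auto
  have S: "(\<Prod>k\<in>{1..<Suc i}. site_sign (p k)) = (\<Prod>k\<in>{1..<i}. site_sign (p k)) * site_sign (p i)"
    using assms by (simp add: prod.atLeastLessThan_Suc)
  \<comment> \<open>The sign on the right is the one additional factor, at site \<open>i\<close>,
    that \<open>c_op (Suc i)\<close> has compared with \<open>c_op i\<close>.\<close>
  have "T_site (\<lambda>s t. u (?u s) t) s t = site_sign s * T_site u s (?u t)" for u s t
    by (cases s; cases t; cases "fst s"; cases "fst t")
      (auto simp: T_site_simps hecke_site_def site_sign_def algebra_simps)
  from this[of "\<lambda>s t. \<phi> (p(i := s, Suc i := t))" "p i" "p (Suc i)"] show ?thesis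
    unfolding T_op_def c_op_def P S by (simp add: T_site_scale fun_upd_twist[of i "Suc i"])
qed

section \<open>The action of the free algebra and its descent to the quotient\<close>

definition gen_op :: "hc_gen \<Rightarrow> (config \<Rightarrow> hc_field) \<Rightarrow> config \<Rightarrow> hc_field" where
  "gen_op g = (case g of Gen_T i \<Rightarrow> T_op i | Gen_c j \<Rightarrow> c_op j)"

definition word_op :: "hc_gen list \<Rightarrow> (config \<Rightarrow> hc_field) \<Rightarrow> config \<Rightarrow> hc_field" where
  "word_op w = foldr gen_op w"

definition free_op :: "hc_free \<Rightarrow> (config \<Rightarrow> hc_field) \<Rightarrow> config \<Rightarrow> hc_field" where
  "free_op x \<phi> p = (\<Sum>w\<in>Poly_Mapping.keys x. Poly_Mapping.lookup x w * word_op w \<phi> p)"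

lemma word_op_simps [simp]:
  "word_op [] \<phi> = \<phi>"
  "word_op (g # w) \<phi> = gen_op g (word_op w \<phi>)"
  "word_op (u @ v) \<phi> = word_op u (word_op v \<phi>)"
  by (simp_all add: word_op_def)

lemma gen_op_linear: "gen_op g (\<lambda>p. a * \<phi> p + b * \<psi> p) p = a * gen_op g \<phi> p + b * gen_op g \<psi> p"
  by (cases g) (simp_all add: gen_op_def T_op_linear c_op_linear)

lemma word_op_linear: "word_op w (\<lambda>p. a * \<phi> p + b * \<psi> p) p = a * word_op w \<phi> p + b * word_op w \<psi> p"
proof (induction w arbitrary: p)
  case (Cons g w)
  have "word_op w (\<lambda>p. a * \<phi> p + b * \<psi> p) = (\<lambda>p. a * word_op w \<phi> p + b * word_op w \<psi> p)"
    by (rule ext) (rule Cons.IH)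
  then show ?case by (simp add: gen_op_linear)
qed simp

lemma free_op_superset:
  assumes "finite S" "Poly_Mapping.keys x \<subseteq> S"
  shows "free_op x \<phi> p = (\<Sum>w\<in>S. Poly_Mapping.lookup x w * word_op w \<phi> p)"
  unfolding free_op_def
  by (rule sum.mono_neutral_left) (use assms in \<open>auto simp: in_keys_iff\<close>)

lemma free_op_add: "free_op (x + y) \<phi> p = free_op x \<phi> p + free_op y \<phi> p"
proof -
  let ?S = "Poly_Mapping.keys x \<union> Poly_Mapping.keys y"
  have "Poly_Mapping.keys (x + y) \<subseteq> ?S" by (rule Poly_Mapping.keys_add)
  then show ?thesis
    by (simp add: free_op_superset[of ?S] lookup_add distrib_right sum.distrib)
qed

lemma free_op_single: "free_op (Poly_Mapping.single w a) \<phi> p = a * word_op w \<phi> p"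
  by (simp add: free_op_def)

lemma free_op_0 [simp]: "free_op 0 \<phi> p = 0"
  by (simp add: free_op_def)

lemma free_op_linear: "free_op x (\<lambda>p. a * \<phi> p + b * \<psi> p) p = a * free_op x \<phi> p + b * free_op x \<psi> p"
  by (simp add: free_op_def word_op_linear sum_distrib_left sum.distrib algebra_simps)

lemma free_op_zero_fun [simp]: "free_op x (\<lambda>p. 0) p = 0"
  using free_op_linear[of x 0 "\<lambda>p. 0" 0 "\<lambda>p. 0" p] by simp

lemma free_op_mult: "free_op (x * y) \<phi> p = free_op x (free_op y \<phi>) p"
proof (induction x rule: poly_mapping_single_induct)
  case (add x u a)
  have "free_op (Poly_Mapping.single u a * y) \<phi> p = a * word_op u (free_op y \<phi>) p"
  proof (induction y rule: poly_mapping_single_induct)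
    case zero
    have "free_op 0 \<phi> = (\<lambda>p. 0)" by (simp add: fun_eq_iff)
    moreover have "word_op u (\<lambda>p. 0) p = 0"
      using word_op_linear[of u 0 "\<lambda>p. 0" 0 "\<lambda>p. 0" p] by simp
    ultimately show ?case by simp
  next
    case (add y v b)
    have "free_op (y + Poly_Mapping.single v b) \<phi> = (\<lambda>p. 1 * free_op y \<phi> p + b * word_op v \<phi> p)"
      by (simp add: fun_eq_iff free_op_add free_op_single)
    then show ?case
      using add.IH by (simp only: word_op_linear) (simp add: distrib_left free_op_add mult_single free_op_single plus_list_def algebra_simps)
  qed
  then show ?case
    using add.IH by (simp add: distrib_right free_op_add free_op_single)
qed simp

lemma free_op_scal: "free_op (scal a) \<phi> p = a * \<phi> p"
  using free_op_single[of "[]" a \<phi> p] by (simp add: scal_def zero_list_def)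

lemma free_op_1 [simp]: "free_op 1 \<phi> p = \<phi> p"
  using free_op_scal[of 1 \<phi> p] by simp

lemma free_op_uminus: "free_op (- x) \<phi> p = - free_op x \<phi> p"
  using free_op_mult[of "scal (-1)" x \<phi> p] free_op_scal[of "-1" "free_op x \<phi>" p] by (simp add: scal_minus)

lemma free_op_diff: "free_op (x - y) \<phi> p = free_op x \<phi> p - free_op y \<phi> p"
  using free_op_add[of x "- y"] by (simp add: free_op_uminus)

lemma free_op_T: "free_op (free_T i) \<phi> = T_op i \<phi>"
  and free_op_c: "free_op (free_c i) \<phi> = c_op i \<phi>"
  by (simp_all add: fun_eq_iff free_gen_def free_op_single gen_op_def)

lemma free_op_mult_fun: "free_op (x * y) \<phi> = free_op x (free_op y \<phi>)"
  by (simp add: fun_eq_iff free_op_mult)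

lemma free_op_relation: "(l, r) \<in> hc_relations n \<Longrightarrow> free_op l \<phi> p = free_op r \<phi> p"
proof (induction rule: hc_relations.induct)
  case (quadratic i)
  have eq: "(free_T i - q \<odot>\<^bsub>\<F> n\<^esub> \<one>\<^bsub>\<F> n\<^esub>) \<otimes>\<^bsub>\<F> n\<^esub> (free_T i + \<one>\<^bsub>\<F> n\<^esub>)
      = free_T i * free_T i + free_T i - scal q * free_T i - scal q"
    by (simp add: algebra_simps)
  show ?case
    unfolding eq by (simp add: free_op_diff free_op_add free_op_mult free_op_scal free_op_T T_op_square algebra_simps)
next
  case (T_commute i j)
  then consider "Suc i < j" | "Suc j < i" by linarith
  then have "T_op i (T_op j \<phi>) p = T_op j (T_op i \<phi>) p"
    by cases (auto intro: T_op_commute T_op_commute[symmetric])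
  then show ?case by (simp add: free_op_mult_fun free_op_T)
next
  case (braid i)
  show ?case by (simp add: free_op_mult_fun free_op_T T_op_braid)
next
  case (c_square i)
  show ?case by (simp add: free_op_mult_fun free_op_c c_op_square)
next
  case (c_anticommute i j)
  then show ?case
    using c_op_anticommute[of i j \<phi> p] by (simp add: free_op_uminus free_op_mult_fun free_op_c)
next
  case (T_c_commute i j)
  then show ?case by (simp add: free_op_mult_fun free_op_T free_op_c T_c_op_commute)
next
  case (T_c_shift i)
  then show ?case by (simp add: free_op_mult_fun free_op_T free_op_c T_c_op_shift)
qed

text \<open>The elements that annihilate every function form a two-sided ideal containing all
  relations, hence containing \<open>hc_ideal n\<close>.\<close>

lemma free_op_hc_ideal:
  assumes "x \<in> hc_ideal n"
  shows "free_op x \<phi> p = 0"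
proof -
  let ?K = "{x \<in> carrier (\<F> n). \<forall>\<phi> p. free_op x \<phi> p = 0}"
  interpret ring "\<F> n" by (rule ring_free_algebra)
  have zero: "free_op x (free_op y \<phi>) p = 0" if "\<forall>\<phi> p. free_op y \<phi> p = 0" for x y \<phi> p
  proof -
    have "free_op y \<phi> = (\<lambda>p. 0)" using that by (simp add: fun_eq_iff)
    then show ?thesis by simp
  qed
  have inv: "inv\<^bsub>add_monoid (\<F> n)\<^esub> x = - x" if "x \<in> carrier (\<F> n)" for x
    using free_a_inv[OF that] by (simp add: a_inv_def)
  have "ideal ?K (\<F> n)"
  proof (rule idealI[OF ring_axioms])
    show "subgroup ?K (add_monoid (\<F> n))"
      by (rule group.subgroupI[OF a_group])
        (auto simp: free_carrier free_op_add free_op_uminus inv[simplified] intro!: exI[of _ 0])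
  qed (auto simp: free_carrier free_op_mult zero)
  moreover have "{l - r | l r. (l, r) \<in> hc_relations n} \<subseteq> ?K"
    by (auto simp: free_op_diff free_op_relation dest: hc_relations_carrier intro: free_carrier)
  ultimately have "hc_ideal n \<subseteq> ?K"
    unfolding hc_ideal_def relation_ideal_def by (rule genideal_minimal)
  then show ?thesis using assms by auto
qed

section \<open>Linear independence\<close>

definition delta :: "config \<Rightarrow> config \<Rightarrow> hc_field" where
  "delta r p = (if p = r then 1 else 0)"

definition perm_config :: "(nat \<Rightarrow> nat) \<Rightarrow> nat set \<Rightarrow> config" where
  "perm_config f I k = (k \<in> I, f k)"

lemma perm_config_inject: "perm_config f I = perm_config g J \<longleftrightarrow> f = g \<and> I = J"
  by (auto simp: perm_config_def fun_eq_iff)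

text \<open>At an ascent with empty spins all terms with factor \<open>q - 1\<close> vanish, so a
  basis vector goes to a single basis vector.\<close>

lemma T_op_delta:
  assumes "f i < f (Suc i)"
  shows "T_op i (delta (perm_config f {})) = delta (perm_config (f \<circ> swap i) {})"
proof
  fix p
  let ?r = "perm_config f {}"
  let ?A = "\<forall>k. k \<noteq> i \<longrightarrow> k \<noteq> Suc i \<longrightarrow> p k = ?r k"
  define A where "A \<longleftrightarrow> ?A"
  let ?u = "\<lambda>s t. if s = (False, f i) \<and> t = (False, f (Suc i)) then 1 else (0 :: hc_field)"
  have "T_site (\<lambda>s t. delta ?r (p(i := s, Suc i := t))) s t = (if ?A then T_site ?u s t else 0)" for s t
  proof -
    have upd: "p(i := s, Suc i := t) = ?r \<longleftrightarrow> ?A \<and> s = (False, f i) \<and> t = (False, f (Suc i))" for s t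
    proof
      assume eq: "p(i := s, Suc i := t) = ?r"
      have "p k = ?r k" if "k \<noteq> i" "k \<noteq> Suc i" for k using fun_cong[OF eq, of k] that by simp
      moreover have "s = (False, f i)" using fun_cong[OF eq, of i] by (simp add: perm_config_def)
      moreover have "t = (False, f (Suc i))" using fun_cong[OF eq, of "Suc i"] by (simp add: perm_config_def)
      ultimately show "?A \<and> s = (False, f i) \<and> t = (False, f (Suc i))" by blast
    next
      assume r: "?A \<and> s = (False, f i) \<and> t = (False, f (Suc i))"
      show "p(i := s, Suc i := t) = ?r"
      proof
        fix k show "(p(i := s, Suc i := t)) k = ?r k"
          using r by (cases "k = i"; cases "k = Suc i") (simp_all add: perm_config_def)
      qed
    qed
    show ?thesis
      unfolding delta_def upd A_def[symmetric] using T_site_scale[of 0 ?u s t] by (cases A) simp_all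
  qed
  moreover have "T_site ?u s t = (if s = (False, f (Suc i)) \<and> t = (False, f i) then 1 else 0)" for s t
    using assms by (cases s; cases t; cases "fst s"; cases "fst t") (auto simp: T_site_simps hecke_site_def)
  moreover have "p = perm_config (f \<circ> swap i) {} \<longleftrightarrow>
      ?A \<and> p i = (False, f (Suc i)) \<and> p (Suc i) = (False, f i)"
  proof
    assume r: "?A \<and> p i = (False, f (Suc i)) \<and> p (Suc i) = (False, f i)"
    show "p = perm_config (f \<circ> swap i) {}"
    proof
      fix k show "p k = perm_config (f \<circ> swap i) {} k"
        using r by (cases "k = i"; cases "k = Suc i") (simp_all add: perm_config_def transpose_def)
    qed
  qed (simp add: perm_config_def transpose_def)
  ultimately show "T_op i (delta ?r) p = delta (perm_config (f \<circ> swap i) {}) p"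
    unfolding T_op_def A_def[symmetric] by (cases A) (simp_all add: delta_def)
qed

lemma c_op_delta:
  "\<exists>e\<in>{1, -1}. c_op j (delta (perm_config f I)) = (\<lambda>p. e * delta (perm_config f (toggle j I)) p)"
proof -
  let ?r = "perm_config f I" and ?r' = "perm_config f (toggle j I)"
  define e where "e = (\<Prod>k\<in>{1..<j}. site_sign (?r k))"
  have "e \<in> {1, -1}"
  proof -
    have "(\<Prod>k\<in>S. site_sign (?r k)) \<in> {1, -1}" for S
      by (induction S rule: infinite_finite_induct) (auto simp: site_sign_def)
    then show ?thesis unfolding e_def .
  qed
  moreover have "c_op j (delta ?r) p = e * delta ?r' p" for p
  proof (cases "p = ?r'")
    case True
    have "(\<Prod>k\<in>{1..<j}. site_sign (p k)) = e"
      unfolding e_def True by (rule prod.cong) (auto simp: perm_config_def toggle_def)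
    moreover have "p(j := (\<not> fst (p j), snd (p j))) = ?r"
      unfolding True by (auto simp: fun_eq_iff perm_config_def toggle_def)
    ultimately show ?thesis using True by (simp add: c_op_def delta_def)
  next
    case False
    have "p(j := (\<not> fst (p j), snd (p j))) \<noteq> ?r"
    proof
      assume r: "p(j := (\<not> fst (p j), snd (p j))) = ?r"
      have "p k = ?r' k" for k
        using fun_cong[OF r, of k] by (cases "p k") (auto simp: perm_config_def toggle_def split: if_splits)
      with False show False by blast
    qed
    then show ?thesis using False by (simp add: c_op_def delta_def)
  qed
  ultimately show ?thesis by blast
qed

lemma permutes_no_descent:
  assumes f: "f permutes {1..n}" and "\<And>i. i \<in> {1..<n} \<Longrightarrow> \<not> f (Suc i) < f i"
  shows "f = id"
proof -
  have "k \<le> n \<longrightarrow> k \<le> f k" if "1 \<le> k" for k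
    using that
  proof (induction k rule: dec_induct)
    case base
    show ?case using permutes_in_image[OF f, of 1] by auto
  next
    case (step k)
    then show ?case
      using assms(2)[of k] permutes_ascent_or_descent[OF f, of k] by fastforce
  qed
  then show ?thesis
    by (intro permutes_natset_ge[OF f]) auto
qed

text \<open>Read from right to left, the factors of \<open>T_elem n f\<close> lead from the identity
  to \<open>f\<close> through ascents, so \<open>T_op_delta\<close> applies at each of them.\<close>

lemma T_elem_delta:
  assumes "f permutes {1..n}"
  shows "free_op (T_elem n f) (delta (perm_config id {})) = delta (perm_config f {})"
  using assms
proof (induction n f rule: T_elem.induct)
  case (1 n f)
  show ?case
  proof (cases "\<exists>i\<in>{1..<n}. f (Suc i) < f i")
    case True
    define i where "i = some_descent n f"
    from True obtain k where k: "k \<in> {1..<n}" "f (Suc k) < f k" by blast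
    have i: "i \<in> {1..<n}" "f (Suc i) < f i"
      using some_descent[OF k] by (simp_all add: i_def)
    have "T_elem n f = free_T i * T_elem n (f \<circ> swap i)"
      using T_elem_some_descent[OF k] by (simp add: i_def)
    moreover have "free_op (T_elem n (f \<circ> swap i)) (delta (perm_config id {})) = delta (perm_config (f \<circ> swap i) {})"
      using "1.IH"[OF True] permutes_comp_swap[OF "1.prems" i(1)] unfolding i_def by blast
    moreover have "T_op i (delta (perm_config (f \<circ> swap i) {})) = delta (perm_config f {})"
      using T_op_delta[of "f \<circ> swap i" i] i(2) by (simp only: swap_swap) simp
    ultimately show ?thesis
      by (simp only: free_op_mult_fun free_op_T)
  next
    case False
    then have f: "f = id" using permutes_no_descent[OF "1.prems"] by blast
    show ?thesis unfolding f T_elem_id by (rule ext) (rule free_op_1)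
  qed
qed

lemma clifford_prod_delta:
  "distinct ks \<Longrightarrow> \<exists>e\<in>{1, -1}. free_op (clifford_prod I ks) (delta (perm_config f {})) =
    (\<lambda>p. e * delta (perm_config f (I \<inter> set ks)) p)"
proof (induction ks)
  case Nil
  show ?case by (auto simp: fun_eq_iff)
next
  case (Cons k ks)
  then obtain e where e: "e \<in> {1, -1}" and IH: "free_op (clifford_prod I ks) (delta (perm_config f {})) =
      (\<lambda>p. e * delta (perm_config f (I \<inter> set ks)) p)"
    by fastforce
  show ?case
  proof (cases "k \<in> I")
    case True
    obtain e' where e': "e' \<in> {1, -1}"
      "c_op k (delta (perm_config f (I \<inter> set ks))) = (\<lambda>p. e' * delta (perm_config f (toggle k (I \<inter> set ks))) p)"
      using c_op_delta by blast
    have "toggle k (I \<inter> set ks) = I \<inter> set (k # ks)"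
      using Cons.prems True by (auto simp: toggle_def)
    moreover have "c_op k (\<lambda>p. e * \<phi> p) p = e * c_op k \<phi> p" for \<phi> p
      using c_op_linear[of k e \<phi> 0 \<phi> p] by simp
    ultimately have "free_op (clifford_prod I (k # ks)) (delta (perm_config f {})) =
        (\<lambda>p. (e * e') * delta (perm_config f (I \<inter> set (k # ks))) p)"
      using True e'(2) by (simp add: fun_eq_iff free_op_mult_fun free_op_c IH mult.assoc)
    moreover have "e * e' \<in> {1, -1}" using e e'(1) by auto
    ultimately show ?thesis by blast
  next
    case False
    then have "I \<inter> set (k # ks) = I \<inter> set ks" by auto
    with False IH e show ?thesis by auto
  qed
qed

lemma CT_elem_delta:
  assumes "f permutes {1..n}" "I \<subseteq> {1..n}"
  shows "\<exists>e\<in>{1, -1}. \<forall>p. free_op (CT_elem n (f, I)) (delta (perm_config id {})) p = e * delta (perm_config f I) p"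
proof -
  have "I \<inter> set [1..<Suc n] = I" using assms(2) by auto
  then show ?thesis
    using clifford_prod_delta[of "[1..<Suc n]" I f] T_elem_delta[OF assms(1)]
    by (auto simp: CT_elem_def C_elem_def free_op_mult_fun)
qed

text \<open>Let the combination act on the cyclic vector and evaluate at the configuration of
  \<open>r\<close>: only the coefficient of \<open>r\<close> survives, up to sign.\<close>

lemma CT_elem_independent:
  assumes "(\<Sum>p\<in>hc_index n. scal (k p) * CT_elem n p) \<in> hc_ideal n" "r \<in> hc_index n"
  shows "k r = 0"
proof -
  have "\<exists>e\<in>{1, -1}. \<forall>P. free_op (CT_elem n p) (delta (perm_config id {})) P = e * delta (perm_config (fst p) (snd p)) P"
    if "p \<in> hc_index n" for p
    using CT_elem_delta[of "fst p" n "snd p"] that by (auto simp: hc_index_def)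
  then obtain e where e: "\<And>p. p \<in> hc_index n \<Longrightarrow> e p \<in> {1, -1}"
    and eq: "\<And>p P. p \<in> hc_index n \<Longrightarrow>
      free_op (CT_elem n p) (delta (perm_config id {})) P = e p * delta (perm_config (fst p) (snd p)) P"
    by metis
  let ?P = "perm_config (fst r) (snd r)"
  have sum: "free_op (\<Sum>p\<in>S. x p) \<phi> P = (\<Sum>p\<in>S. free_op (x p) \<phi> P)" for x S \<phi> P
    by (induction S rule: infinite_finite_induct) (auto simp: free_op_add)
  have "0 = free_op (\<Sum>p\<in>hc_index n. scal (k p) * CT_elem n p) (delta (perm_config id {})) ?P"
    using free_op_hc_ideal[OF assms(1)] by simp
  also have "\<dots> = (\<Sum>p\<in>hc_index n. k p * (e p * delta (perm_config (fst p) (snd p)) ?P))"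
    unfolding sum by (intro sum.cong) (simp_all add: free_op_mult free_op_scal eq)
  also have "\<dots> = (\<Sum>p\<in>hc_index n. if p = r then k p * e p else 0)"
    by (intro sum.cong) (auto simp: delta_def perm_config_inject prod_eq_iff)
  also have "\<dots> = k r * e r"
    using assms(2) finite_hc_index by simp
  finally show ?thesis using e[OF assms(2)] by auto
qed

section \<open>The diagonal coefficients of \<open>T\<^sub>w\<close>\<close>

definition T_word :: "nat list \<Rightarrow> hc_free" where
  "T_word w = prod_list (map free_T w)"

lemma T_word_simps [simp]: "T_word [] = 1" "T_word (i # w) = free_T i * T_word w"
  by (simp_all add: T_word_def)

lemma T_word_carrier: "set w \<subseteq> {1..<n} \<Longrightarrow> T_word w \<in> carrier (\<F> n)"
  by (induction w) (auto intro!: free_carrier_1 free_carrier_mult carrier_T)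

lemma finite_permutes: "finite {f. f permutes {1..n::nat}}"
  by (simp add: finite_permutations)

text \<open>The initial segment \<open>{..j}\<close> is stable under every adjacent transposition
  except the one at \<open>j\<close>, so it detects the letter \<open>j\<close> in a word.\<close>

lemma swap_image_atMost: "i \<noteq> j \<Longrightarrow> swap i ` {..j} = {..j}"
proof -
  assume ij: "i \<noteq> j"
  have sub: "swap i ` {..j} \<subseteq> {..j}" using ij by (auto simp: transpose_def)
  show ?thesis
  proof (rule subset_antisym[OF sub])
    have "swap i ` swap i ` {..j} = {..j}" by (simp add: image_comp)
    then show "{..j} \<subseteq> swap i ` {..j}" using image_mono[OF sub, of "swap i"] by simp
  qed
qed

lemma swap_image_atMost_self: "swap i ` {..i} \<noteq> {..i}"
proof
  assume "swap i ` {..i} = {..i}"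
  moreover have "Suc i \<in> swap i ` {..i}" by (rule image_eqI[of _ _ i]) simp_all
  ultimately show False by simp
qed

lemma comp_swap_image_atMost: "i \<noteq> j \<Longrightarrow> (f \<circ> swap i) ` {..j} = f ` {..j}"
  by (simp only: image_comp[symmetric] swap_image_atMost not_False_eq_True)

lemma comp_swap_image_atMost_self:
  assumes "inj f"
  shows "(f \<circ> swap i) ` {..i} \<noteq> f ` {..i}"
  by (simp only: image_comp[symmetric] inj_image_eq_iff[OF assms] swap_image_atMost_self not_False_eq_True)

text \<open>The diagonal coefficient of \<open>T\<^sub>w\<close>: each letter \<open>s\<^sub>i\<close> either moves \<open>f\<close> to \<open>f \<circ> swap i\<close> or, at a
  descent, leaves it in place with weight \<open>q - 1\<close>. Since the letters are distinct, the set \<open>f ` {..i}\<close>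
  can only be changed by the letter \<open>i\<close>, so a path that moves once never returns to \<open>f\<close>.\<close>

lemma T_word_T_elem:
  assumes "set w \<subseteq> {1..<n}" "f permutes {1..n}" "distinct w"
  shows "\<exists>K. hc_eq n (T_word w * T_elem n f) (\<Sum>g | g permutes {1..n}. scal (K g) * T_elem n g) \<and>
    (\<forall>g. K g \<noteq> 0 \<longrightarrow> (\<forall>i. i \<notin> set w \<longrightarrow> g ` {..i} = f ` {..i})) \<and>
    K f = (if \<forall>i\<in>set w. f (Suc i) < f i then (q - 1) ^ length w else 0)"
  using assms
proof (induction w)
  case Nil
  show ?case
  proof (intro exI[of _ "\<lambda>g. if g = f then 1 else 0"] conjI)
    have "(\<Sum>g | g permutes {1..n}. scal (if g = f then 1 else 0) * T_elem n g) =
        (\<Sum>g | g permutes {1..n}. if g = f then T_elem n g else 0)"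
      by (intro sum.cong) auto
    then show "hc_eq n (T_word [] * T_elem n f)
        (\<Sum>g | g permutes {1..n}. scal (if g = f then 1 else 0) * T_elem n g)"
      using Nil finite_permutes by simp
  qed (auto split: if_splits)
next
  case (Cons i w)
  let ?P = "{g. g permutes {1..n}}"
  have i: "i \<in> {1..<n}" "i \<notin> set w" using Cons.prems by auto
  obtain K where K: "hc_eq n (T_word w * T_elem n f) (\<Sum>g\<in>?P. scal (K g) * T_elem n g)"
    and supp: "\<And>g j. K g \<noteq> 0 \<Longrightarrow> j \<notin> set w \<Longrightarrow> g ` {..j} = f ` {..j}"
    and diag: "K f = (if \<forall>i\<in>set w. f (Suc i) < f i then (q - 1) ^ length w else 0)"
    using Cons by auto
  let ?s = "\<lambda>g. g \<circ> swap i"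
  \<comment> \<open>\<open>up g\<close> and \<open>stay g\<close> are the coefficients of the moved
    and of the unmoved element in \<open>T_i\<close> times \<open>T_elem n g\<close>. In
    \<open>L g\<close> the second summand is the contribution that arrives from the neighbour
    \<open>?s g\<close>.\<close>
  define up where "up g = (if g i < g (Suc i) then 1 else q)" for g :: "nat \<Rightarrow> nat"
  define stay where "stay g = (if g i < g (Suc i) then 0 else q - 1)" for g :: "nat \<Rightarrow> nat"
  define L where "L g = stay g * K g + up (?s g) * K (?s g)" for g
  have step: "hc_eq n (free_T i * T_elem n g) (scal (stay g) * T_elem n g + scal (up g) * T_elem n (?s g))"
    if "g \<in> ?P" for g
  proof (cases "g i < g (Suc i)")
    case True
    then show ?thesis using T_T_elem_ascent[OF i(1) True] by (simp add: stay_def up_def)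
  next
    case False
    then have "g (Suc i) < g i" using permutes_ascent_or_descent[of g n i] that by blast
    from T_T_elem_descent[OF i(1) this] False show ?thesis by (simp add: stay_def up_def)
  qed
  have invol: "?s (?s g) = g" for g :: "nat \<Rightarrow> nat" by (rule swap_swap)
  have "hc_eq n (T_word (i # w) * T_elem n f) (\<Sum>g\<in>?P. scal (K g) * (free_T i * T_elem n g))"
    using hc_eq_mult_left[OF K carrier_T[OF i(1)]]
    by (simp add: sum_distrib_left scal_left_central mult.assoc)
  also have "hc_eq n \<dots> (\<Sum>g\<in>?P. scal (K g) * (scal (stay g) * T_elem n g + scal (up g) * T_elem n (?s g)))"
    by (intro hc_eq_sum hc_eq_scal step)
  also have "\<dots> = (\<Sum>g\<in>?P. scal (stay g * K g) * T_elem n g) + (\<Sum>g\<in>?P. scal (up g * K g) * T_elem n (?s g))"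
    by (simp add: distrib_left sum.distrib scal_mult mult.assoc mult.commute[of "_ :: hc_field"])
  also have "(\<Sum>g\<in>?P. scal (up g * K g) * T_elem n (?s g)) = (\<Sum>g\<in>?P. scal (up (?s g) * K (?s g)) * T_elem n g)"
    by (rule sum.reindex_bij_witness[of _ ?s ?s]) (simp_all only: invol mem_Collect_eq permutes_comp_swap i(1))
  also have "(\<Sum>g\<in>?P. scal (stay g * K g) * T_elem n g) + \<dots> = (\<Sum>g\<in>?P. scal (L g) * T_elem n g)"
    by (simp only: L_def scal_add distrib_right sum.distrib)
  finally have 1: "hc_eq n (T_word (i # w) * T_elem n f) (\<Sum>g\<in>?P. scal (L g) * T_elem n g)" .
  have 2: "g ` {..j} = f ` {..j}" if "L g \<noteq> 0" "j \<notin> set (i # w)" for g j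
  proof -
    have "K g \<noteq> 0 \<or> K (?s g) \<noteq> 0" using that(1) by (auto simp: L_def)
    moreover have j: "j \<notin> set w" "i \<noteq> j" using that(2) by auto
    ultimately have "g ` {..j} = f ` {..j} \<or> ?s g ` {..j} = f ` {..j}" using supp by blast
    then show ?thesis using comp_swap_image_atMost[OF j(2), of g] by metis
  qed
  \<comment> \<open>Nothing arrives at \<open>f\<close> from its neighbour: \<open>w\<close> lacks
    the letter \<open>i\<close>, but \<open>f\<close> and \<open>?s f\<close> have different images
    of \<open>{..i}\<close>.\<close>
  have "K (?s f) = 0"
    using supp[of "?s f" i] comp_swap_image_atMost_self[OF permutes_inj[OF Cons.prems(2)]] i(2) by blast
  moreover have "stay f = (if f (Suc i) < f i then q - 1 else 0)"
    using permutes_ascent_or_descent[OF Cons.prems(2), of i] by (auto simp: stay_def)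
  ultimately have 3: "L f = (if \<forall>j\<in>set (i # w). f (Suc j) < f j then (q - 1) ^ length (i # w) else 0)"
    by (simp add: L_def diag)
  show ?case using 1 2 3 by blast
qed

text \<open>The factor \<open>C_I\<close> on the right is untouched by left multiplication, so the
  coefficients for \<open>T_elem\<close> are reused on the slice with second component
  \<open>I\<close>.\<close>

lemma T_word_TC_elem:
  assumes w: "set w \<subseteq> {1..<n}" "distinct w" and p: "p \<in> hc_index n"
  shows "\<exists>M. hc_eq n (T_word w * TC_elem n p) (\<Sum>r\<in>hc_index n. scal (M r) * TC_elem n r) \<and>
    M p = (if \<forall>i\<in>set w. fst p (Suc i) < fst p i then (q - 1) ^ length w else 0)"
proof -
  let ?P = "{g. g permutes {1..n}}"
  obtain f I where fI: "p = (f, I)" by (cases p)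
  have f: "f permutes {1..n}" and I: "I \<subseteq> {1..n}" using p fI by (auto simp: hc_index_def)
  obtain K where K: "hc_eq n (T_word w * T_elem n f) (\<Sum>g\<in>?P. scal (K g) * T_elem n g)"
    and diag: "K f = (if \<forall>i\<in>set w. f (Suc i) < f i then (q - 1) ^ length w else 0)"
    using T_word_T_elem[OF w(1) f w(2)] by auto
  let ?M = "\<lambda>r. if snd r = I then K (fst r) else 0"
  have "hc_eq n (T_word w * TC_elem n p) (\<Sum>g\<in>?P. scal (K g) * TC_elem n (g, I))"
    using hc_eq_mult_right[OF K C_elem_carrier[of n I]]
    by (simp add: TC_elem_def fI sum_distrib_right mult.assoc)
  also have "(\<Sum>g\<in>?P. scal (K g) * TC_elem n (g, I)) =
      (\<Sum>g\<in>?P. \<Sum>J\<in>Pow {1..n}. if J = I then scal (K g) * TC_elem n (g, J) else 0)"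
    using I by (intro sum.cong) simp_all
  also have "\<dots> = (\<Sum>r\<in>hc_index n. scal (?M r) * TC_elem n r)"
    unfolding hc_index_def sum.cartesian_product by (intro sum.cong refl) (simp split: prod.split)
  finally show ?thesis using diag by (intro exI[of _ ?M]) (simp add: fI)
qed

section \<open>Basis independence of the trace\<close>

lemma basis_facts:
  fixes V :: "('k::field, 'v, 'm) module_scheme"
  assumes "vectorspace class_ring V" and basis: "vectorspace.basis class_ring V B"
  shows "\<not> LinearCombinations.module.lin_dep class_ring V B"
    and "LinearCombinations.module.span class_ring V B = carrier V" and "B \<subseteq> carrier V"
proof -
  interpret vectorspace class_ring V by fact
  show "lin_indpt B" "span B = carrier V" "B \<subseteq> carrier V"
    using basis by (simp_all add: basis_def)
qed

lemma lincomb_basis_coord: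
  fixes V :: "('k::field, 'v, 'm) module_scheme"
  assumes "vectorspace class_ring V" and B: "finite B" "vectorspace.basis class_ring V B" and x: "x \<in> carrier V"
  shows "LinearCombinations.module.lincomb V (basis_coord V B x) B = x"
proof -
  interpret vectorspace class_ring V by fact
  have "x \<in> span B" "B \<subseteq> carrier V"
    using basis_facts[OF assms(1) B(2)] x by simp_all
  then obtain a where "lincomb a B = x"
    using finite_in_span[OF B(1)] by blast
  then show ?thesis unfolding basis_coord_def by (rule someI[where P = "\<lambda>a. lincomb a B = x"])
qed

text \<open>Coordinates are picked by choice, so a linear independence argument has to identify them
  with any given coefficients.\<close>

lemma basis_coord_unique:
  fixes V :: "('k::field, 'v, 'm) module_scheme"
  assumes "vectorspace class_ring V" and B: "finite B" "vectorspace.basis class_ring V B" and b: "b \<in> B"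
  shows "basis_coord V B (LinearCombinations.module.lincomb V a B) b = a b"
proof -
  interpret vectorspace class_ring V by fact
  have sub: "B \<subseteq> carrier V" and indep: "lin_indpt B"
    using basis_facts[OF assms(1) B(2)] by simp_all
  let ?c = "basis_coord V B (lincomb a B)"
  have cl: "lincomb a B \<in> carrier V" using sub by (intro lincomb_closed) auto
  have "lincomb (\<lambda>v. ?c v \<ominus>\<^bsub>class_ring\<^esub> a v) B = lincomb ?c B \<ominus>\<^bsub>V\<^esub> lincomb a B"
    using B(1) sub by (intro lincomb_diff) auto
  also have "\<dots> = \<zero>\<^bsub>V\<^esub>"
    using lincomb_basis_coord[OF assms(1) B cl] cl by (simp add: a_minus_def M.r_neg)
  finally have "lincomb (\<lambda>v. ?c v - a v) B = \<zero>\<^bsub>V\<^esub>"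
    by (simp add: class_ring_simps)
  moreover have "d b = 0" if "lincomb d B = \<zero>\<^bsub>V\<^esub>" for d
    using indep B(1) b that unfolding lin_dep_def by auto
  ultimately have "?c b - a b = 0"
    by blast
  then show ?thesis by simp
qed

lemma basis_coord_add:
  fixes V :: "('k::field, 'v, 'm) module_scheme"
  assumes V: "vectorspace class_ring V" and B: "finite B" "vectorspace.basis class_ring V B" and b: "b \<in> B"
    and x: "x \<in> carrier V" and y: "y \<in> carrier V"
  shows "basis_coord V B (x \<oplus>\<^bsub>V\<^esub> y) b = basis_coord V B x b + basis_coord V B y b"
proof -
  interpret vectorspace class_ring V by fact
  have sub: "B \<subseteq> carrier V" using basis_facts[OF V B(2)] by simp
  let ?c = "basis_coord V B"
  have "lincomb (\<lambda>v. ?c x v \<oplus>\<^bsub>class_ring\<^esub> ?c y v) B = lincomb (?c x) B \<oplus>\<^bsub>V\<^esub> lincomb (?c y) B"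
    using B(1) sub by (intro lincomb_sum) auto
  then have "x \<oplus>\<^bsub>V\<^esub> y = lincomb (\<lambda>v. ?c x v + ?c y v) B"
    by (simp add: lincomb_basis_coord[OF V B] x y)
  then show ?thesis by (simp add: basis_coord_unique[OF V B b])
qed

lemma basis_coord_smult:
  fixes V :: "('k::field, 'v, 'm) module_scheme"
  assumes V: "vectorspace class_ring V" and B: "finite B" "vectorspace.basis class_ring V B" and b: "b \<in> B"
    and x: "x \<in> carrier V"
  shows "basis_coord V B (k \<odot>\<^bsub>V\<^esub> x) b = k * basis_coord V B x b"
proof -
  interpret vectorspace class_ring V by fact
  have sub: "B \<subseteq> carrier V" using basis_facts[OF V B(2)] by simp
  let ?c = "basis_coord V B"
  have "lincomb (\<lambda>v. k \<otimes>\<^bsub>class_ring\<^esub> ?c x v) B = k \<odot>\<^bsub>V\<^esub> lincomb (?c x) B"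
    using sub by (intro lincomb_smult) auto
  then have "k \<odot>\<^bsub>V\<^esub> x = lincomb (\<lambda>v. k * ?c x v) B"
    by (simp add: lincomb_basis_coord[OF V B] x)
  then show ?thesis by (simp add: basis_coord_unique[OF V B b])
qed

lemma linear_functional_finsum:
  fixes V :: "('k::field, 'v, 'm) module_scheme"
  assumes V: "vectorspace class_ring V"
    and add: "\<And>x y. x \<in> carrier V \<Longrightarrow> y \<in> carrier V \<Longrightarrow> g (x \<oplus>\<^bsub>V\<^esub> y) = (g x + g y :: 'k)"
    and smult: "\<And>k x. x \<in> carrier V \<Longrightarrow> g (k \<odot>\<^bsub>V\<^esub> x) = k * g x"
    and S: "finite S" "\<And>i. i \<in> S \<Longrightarrow> x i \<in> carrier V"
  shows "g (\<Oplus>\<^bsub>V\<^esub>i\<in>S. k i \<odot>\<^bsub>V\<^esub> x i) = (\<Sum>i\<in>S. k i * g (x i))"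
  using S
proof (induction S rule: finite_induct)
  case empty
  interpret vectorspace class_ring V by fact
  have "g \<zero>\<^bsub>V\<^esub> = g (0 \<odot>\<^bsub>V\<^esub> \<zero>\<^bsub>V\<^esub>)" by (simp add: smult_r_null)
  also have "\<dots> = 0 * g \<zero>\<^bsub>V\<^esub>" by (rule smult) simp
  finally show ?case by simp
next
  case (insert i S)
  interpret vectorspace class_ring V by fact
  have cl: "(\<Oplus>\<^bsub>V\<^esub>i\<in>S. k i \<odot>\<^bsub>V\<^esub> x i) \<in> carrier V" "k i \<odot>\<^bsub>V\<^esub> x i \<in> carrier V"
    using insert.prems by (auto intro!: M.finsum_closed)
  have "(\<Oplus>\<^bsub>V\<^esub>i\<in>insert i S. k i \<odot>\<^bsub>V\<^esub> x i) = k i \<odot>\<^bsub>V\<^esub> x i \<oplus>\<^bsub>V\<^esub> (\<Oplus>\<^bsub>V\<^esub>i\<in>S. k i \<odot>\<^bsub>V\<^esub> x i)"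
    using insert.prems insert.hyps by (intro M.finsum_insert) auto
  then show ?case
    using insert cl by (simp add: add smult)
qed

definition linear_endo :: "('k::field, 'v, 'm) module_scheme \<Rightarrow> ('v \<Rightarrow> 'v) \<Rightarrow> bool" where
  "linear_endo V f \<longleftrightarrow> (\<forall>x\<in>carrier V. f x \<in> carrier V) \<and>
    (\<forall>x\<in>carrier V. \<forall>y\<in>carrier V. f (x \<oplus>\<^bsub>V\<^esub> y) = f x \<oplus>\<^bsub>V\<^esub> f y) \<and>
    (\<forall>k. \<forall>x\<in>carrier V. f (k \<odot>\<^bsub>V\<^esub> x) = k \<odot>\<^bsub>V\<^esub> f x)"

text \<open>With \<open>b = \<Sum>\<^sub>b\<^sub>' u\<^sub>b\<^sub>b\<^sub>' b'\<close> and \<open>f b' = \<Sum>\<^sub>b w\<^sub>b\<^sub>'\<^sub>b b\<close> both traces are the double sum of \<open>u\<^sub>b\<^sub>b\<^sub>' w\<^sub>b\<^sub>'\<^sub>b\<close>.\<close>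

lemma trace_basis_independent:
  fixes V :: "('k::field, 'v, 'm) module_scheme"
  assumes V: "vectorspace class_ring V" and f: "linear_endo V f"
    and B: "finite B" "vectorspace.basis class_ring V B"
    and B': "finite B'" "vectorspace.basis class_ring V B'"
  shows "(\<Sum>b\<in>B. basis_coord V B (f b) b) = (\<Sum>b\<in>B'. basis_coord V B' (f b) b)"
proof -
  interpret vectorspace class_ring V by fact
  note sub = basis_facts(3)[OF V B(2)] and sub' = basis_facts(3)[OF V B'(2)]
  let ?c = "basis_coord V B" and ?c' = "basis_coord V B'"
  have fc: "f x \<in> carrier V" if "x \<in> carrier V" for x using f that by (simp add: linear_endo_def)
  have "?c (f b) b = (\<Sum>b'\<in>B'. ?c' b b' * ?c (f b') b)" if b: "b \<in> B" for b
  proof -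
    have bV: "b \<in> carrier V" using b sub by blast
    have "?c (f (lincomb (?c' b) B')) b = (\<Sum>b'\<in>B'. ?c' b b' * ?c (f b') b)"
      unfolding lincomb_def
      using f sub' B'(1)
      by (intro linear_functional_finsum[where g = "\<lambda>x. ?c (f x) b", OF V])
        (auto simp: linear_endo_def basis_coord_add[OF V B b] basis_coord_smult[OF V B b])
    then show ?thesis by (simp add: lincomb_basis_coord[OF V B' bV])
  qed
  then have "(\<Sum>b\<in>B. ?c (f b) b) = (\<Sum>b\<in>B. \<Sum>b'\<in>B'. ?c' b b' * ?c (f b') b)"
    by simp
  also have "\<dots> = (\<Sum>b'\<in>B'. \<Sum>b\<in>B. ?c (f b') b * ?c' b b')"
    by (subst sum.swap) (simp add: mult.commute)
  also have "\<dots> = (\<Sum>b'\<in>B'. ?c' (f b') b')"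
  proof (rule sum.cong[OF refl])
    fix b' assume b': "b' \<in> B'"
    have fV: "f b' \<in> carrier V" using b' sub' fc by blast
    have "?c' (lincomb (?c (f b')) B) b' = (\<Sum>b\<in>B. ?c (f b') b * ?c' b b')"
      unfolding lincomb_def
      using sub B(1)
      by (intro linear_functional_finsum[where g = "\<lambda>x. ?c' x b'", OF V])
        (auto simp: basis_coord_add[OF V B' b'] basis_coord_smult[OF V B' b'])
    then show "(\<Sum>b\<in>B. ?c (f b') b * ?c' b b') = ?c' (f b') b'"
      by (simp add: lincomb_basis_coord[OF V B fV])
  qed
  finally show ?thesis .
qed

lemma basis_coord_basis:
  fixes V :: "('k::field, 'v, 'm) module_scheme"
  assumes V: "vectorspace class_ring V" and B: "finite B" "vectorspace.basis class_ring V B"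
    and b: "b \<in> B" "b' \<in> B"
  shows "basis_coord V B b b' = (if b' = b then 1 else 0)"
proof -
  interpret vectorspace class_ring V by fact
  note sub = basis_facts(3)[OF V B(2)]
  have "lincomb (\<lambda>v. if v = b then 1 else 0) B = (\<Oplus>\<^bsub>V\<^esub>v\<in>B. if b = v then v else \<zero>\<^bsub>V\<^esub>)"
    unfolding lincomb_def using sub by (intro M.finsum_cong') (auto simp: smult_l_null[simplified] smult_one[simplified])
  also have "\<dots> = b"
    using sub b B(1) by (intro M.finsum_singleton) auto
  finally show ?thesis using basis_coord_unique[OF V B b(2), of "\<lambda>v. if v = b then 1 else 0"] by simp
qed

lemma operator_trace_family:
  fixes V :: "('k::field, 'v, 'm) module_scheme"
  assumes V: "vectorspace class_ring V" and f: "linear_endo V f"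
    and J: "finite J" "inj_on v J" "vectorspace.basis class_ring V (v ` J)"
    and M: "\<And>j. j \<in> J \<Longrightarrow> f (v j) = (\<Oplus>\<^bsub>V\<^esub>i\<in>J. M j i \<odot>\<^bsub>V\<^esub> v i)"
  shows "operator_trace V f = (\<Sum>j\<in>J. M j j)"
proof -
  interpret vectorspace class_ring V by fact
  define B where "B = (SOME B. finite B \<and> basis B)"
  have "finite B \<and> basis B"
    unfolding B_def by (rule someI[of _ "v ` J"]) (use J in simp)
  then have B: "finite B" "basis B" by simp_all
  have vJ: "finite (v ` J)" using J(1) by simp
  note sub = basis_facts(3)[OF V J(3)]
  have "operator_trace V f = (\<Sum>b\<in>B. basis_coord V B (f b) b)"
    by (simp add: operator_trace_def B_def Let_def)
  also have "\<dots> = (\<Sum>b\<in>v ` J. basis_coord V (v ` J) (f b) b)"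
    by (rule trace_basis_independent[OF V f B vJ J(3)])
  also have "\<dots> = (\<Sum>j\<in>J. basis_coord V (v ` J) (f (v j)) (v j))"
    using J(2) by (simp add: sum.reindex)
  also have "\<dots> = (\<Sum>j\<in>J. M j j)"
  proof (rule sum.cong[OF refl])
    fix j assume j: "j \<in> J"
    let ?c = "basis_coord V (v ` J)"
    have vj: "v j \<in> v ` J" using j by simp
    have "?c (f (v j)) (v j) = (\<Sum>i\<in>J. M j i * ?c (v i) (v j))"
      unfolding M[OF j] using sub J(1)
      by (intro linear_functional_finsum[where g = "\<lambda>x. ?c x (v j)", OF V])
        (auto simp: basis_coord_add[OF V vJ J(3) vj] basis_coord_smult[OF V vJ J(3) vj])
    also have "\<dots> = (\<Sum>i\<in>J. if i = j then M j i else 0)"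
      using J(2) j by (intro sum.cong) (auto simp: basis_coord_basis[OF V vJ J(3)] inj_on_eq_iff)
    finally show "?c (f (v j)) (v j) = M j j" using J(1) j by simp
  qed
  finally show ?thesis .
qed

text \<open>The independent family \<open>u\<close> forces the dimension to be at least
  \<open>card J\<close>, while \<open>v\<close> spans with at most \<open>card J\<close> vectors.
  Equality must hold, so \<open>v\<close> has no repetitions and is a basis.\<close>

lemma basis_of_spanning_family:
  fixes V :: "('k::field, 'v, 'm) module_scheme"
  assumes V: "vectorspace class_ring V" and J: "finite J"
    and v: "\<And>j. j \<in> J \<Longrightarrow> v j \<in> carrier V" and u: "\<And>j. j \<in> J \<Longrightarrow> u j \<in> carrier V"
    and span: "\<And>x. x \<in> carrier V \<Longrightarrow> \<exists>k. x = (\<Oplus>\<^bsub>V\<^esub>j\<in>J. k j \<odot>\<^bsub>V\<^esub> v j)"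
    and inj: "inj_on u J"
    and indep: "\<And>k j. (\<Oplus>\<^bsub>V\<^esub>j\<in>J. k j \<odot>\<^bsub>V\<^esub> u j) = \<zero>\<^bsub>V\<^esub> \<Longrightarrow> j \<in> J \<Longrightarrow> k j = 0"
  shows "inj_on v J" "vectorspace.basis class_ring V (v ` J)"
proof -
  interpret vectorspace class_ring V by fact
  have vJ: "finite (v ` J)" "v ` J \<subseteq> carrier V" and uJ: "finite (u ` J)" "u ` J \<subseteq> carrier V"
    using J v u by auto
  interpret S: submodule "class_ring" "LinearCombinations.module.span class_ring V (v ` J)" V
    by (rule span_is_submodule[OF vJ(2)])
  have mem: "(\<Oplus>\<^bsub>V\<^esub>j\<in>S. k j \<odot>\<^bsub>V\<^esub> v j) \<in> span (v ` J)" if "S \<subseteq> J" for S k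
    using finite_subset[OF that J] that
  proof (induction S rule: finite_induct)
    case empty
    then show ?case using S.zero_closed by simp
  next
    case (insert i S)
    have "v i \<in> span (v ` J)" using in_own_span[OF vJ(2)] insert.prems by auto
    then show ?case
      using insert v by (subst M.finsum_insert) (auto simp: Pi_def subset_iff)
  qed
  have gen: "gen_set (v ` J)"
  proof
    show "span (v ` J) \<subseteq> carrier V" by (rule span_is_subset2[OF vJ(2)])
    show "carrier V \<subseteq> span (v ` J)"
      using span mem[OF subset_refl] by (metis subsetI)
  qed
  have "lin_indpt (u ` J)"
  proof (rule finite_lin_indpt2[OF uJ])
    fix a assume "lincomb a (u ` J) = \<zero>\<^bsub>V\<^esub>"
    moreover have "lincomb a (u ` J) = (\<Oplus>\<^bsub>V\<^esub>j\<in>J. a (u j) \<odot>\<^bsub>V\<^esub> u j)"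
      unfolding lincomb_def using inj u by (intro M.finsum_reindex) auto
    ultimately have "(\<Oplus>\<^bsub>V\<^esub>j\<in>J. a (u j) \<odot>\<^bsub>V\<^esub> u j) = \<zero>\<^bsub>V\<^esub>" by (simp only:)
    then have "a (u j) = 0" if "j \<in> J" for j by (rule indep[OF _ that])
    then show "\<forall>w\<in>u ` J. a w = \<zero>\<^bsub>class_ring\<^esub>" by auto
  qed
  moreover have "fin_dim" unfolding fin_dim_def using vJ gen by blast
  ultimately have "card (u ` J) \<le> dim" using li_le_dim uJ(2) by blast
  then have dim: "card J \<le> dim" using card_image[OF inj] by simp
  show "basis (v ` J)"
    using dim_gen_is_basis[OF vJ gen] card_image_le[OF J, of v] dim by linarith
  show "inj_on v J"
    using gen_ge_dim[OF vJ gen] card_image_le[OF J, of v] dim by (intro eq_card_imp_inj_on[OF J]) linarith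
qed

section \<open>The regular representation\<close>

definition hc_class :: "nat \<Rightarrow> hc_free \<Rightarrow> hc_free set" where
  "hc_class n x = hc_ideal n +>\<^bsub>\<F> n\<^esub> x"

lemma hc_class_eq_iff:
  assumes "x \<in> carrier (\<F> n)" "y \<in> carrier (\<F> n)"
  shows "hc_class n x = hc_class n y \<longleftrightarrow> hc_eq n x y"
proof -
  interpret ideal "hc_ideal n" "\<F> n" by (rule ideal_hc_ideal)
  have "x \<ominus>\<^bsub>\<F> n\<^esub> y = x - y"
    using assms by (simp add: a_minus_def free_a_inv)
  then show ?thesis
    using quotient_eq_iff_same_a_r_cos[OF is_ideal assms] by (simp add: hc_class_def hc_eq_def)
qed

lemma hecke_clifford_carrier: "carrier (hecke_clifford n) = hc_class n ` carrier (\<F> n)"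
  by (auto simp: hecke_clifford_def quotient_algebra_def FactRing_def A_RCOSETS_def RCOSETS_def hc_class_def a_r_coset_def)

lemma hecke_clifford_mult:
  assumes "x \<in> carrier (\<F> n)" "y \<in> carrier (\<F> n)"
  shows "hc_class n x \<otimes>\<^bsub>hecke_clifford n\<^esub> hc_class n y = hc_class n (x * y)"
  using ideal.rcoset_mult_add[OF ideal_hc_ideal assms]
  by (simp add: hecke_clifford_def quotient_algebra_def FactRing_def hc_class_def)

lemma hecke_clifford_add:
  assumes "x \<in> carrier (\<F> n)" "y \<in> carrier (\<F> n)"
  shows "hc_class n x \<oplus>\<^bsub>hecke_clifford n\<^esub> hc_class n y = hc_class n (x + y)"
  using ideal.a_rcos_sum[OF ideal_hc_ideal assms]
  by (simp add: hecke_clifford_def quotient_algebra_def FactRing_def hc_class_def)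

lemma hecke_clifford_one: "\<one>\<^bsub>hecke_clifford n\<^esub> = hc_class n 1"
  by (simp add: hecke_clifford_def quotient_algebra_def FactRing_def hc_class_def)

lemma hecke_clifford_zero: "\<zero>\<^bsub>hecke_clifford n\<^esub> = hc_class n 0"
proof -
  interpret ideal "hc_ideal n" "\<F> n" by (rule ideal_hc_ideal)
  have "hc_ideal n +>\<^bsub>\<F> n\<^esub> \<zero>\<^bsub>\<F> n\<^esub> = hc_ideal n"
    using a_coset_add_zero[OF a_subset] .
  then show ?thesis
    by (simp add: hecke_clifford_def quotient_algebra_def FactRing_def hc_class_def)
qed

lemma hc_class_self: "x \<in> carrier (\<F> n) \<Longrightarrow> x \<in> hc_class n x"
  using ideal_hc_ideal[of n] unfolding hc_class_def
  by (meson abelian_subgroup.a_rcos_self abelian_subgroupI3 additive_subgroup.a_subset ideal.axioms(1) ideal_def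
      ring.is_abelian_group)

lemma hecke_clifford_smult:
  assumes x: "x \<in> carrier (\<F> n)"
  shows "k \<odot>\<^bsub>hecke_clifford n\<^esub> hc_class n x = hc_class n (scal k * x)"
proof -
  \<comment> \<open>Scalar multiplication of a coset is a union over all representatives; each
    contributes the same coset, and the coset is nonempty.\<close>
  have "hc_class n (scal k * y) = hc_class n (scal k * x)" if y: "y \<in> hc_class n x" for y
  proof -
    obtain h where h: "h \<in> hc_ideal n" "y = h + x"
      using y by (auto simp: hc_class_def a_r_coset_def r_coset_def)
    have hC: "h \<in> carrier (\<F> n)"
      using ideal.Icarr[OF ideal_hc_ideal h(1)] .
    have "hc_eq n y x" using h by (simp add: hc_eq_def)
    then show ?thesis
      using x h(2) hC by (subst hc_class_eq_iff) (auto intro!: free_carrier hc_eq_scal)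
  qed
  moreover have "hc_class n x \<noteq> {}" using hc_class_self[OF x] by blast
  ultimately have "(\<Union>y\<in>hc_class n x. hc_class n (scal k * y)) = hc_class n (scal k * x)"
    by auto
  then show ?thesis
    by (simp add: hecke_clifford_def quotient_algebra_def hc_class_def)
qed

lemmas hecke_clifford_simps =
  hecke_clifford_mult hecke_clifford_add hecke_clifford_smult hecke_clifford_one hecke_clifford_zero

lemma vectorspace_hecke_clifford: "vectorspace class_ring (hecke_clifford n)"
proof (rule vs_criteria)
  show "field (class_ring :: hc_field ring)" by (rule class_field)
  show "\<forall>v\<in>carrier (hecke_clifford n). \<exists>v'\<in>carrier (hecke_clifford n).
      v \<oplus>\<^bsub>hecke_clifford n\<^esub> v' = \<zero>\<^bsub>hecke_clifford n\<^esub>"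
  proof
    fix v assume "v \<in> carrier (hecke_clifford n)"
    then obtain x where x: "x \<in> carrier (\<F> n)" "v = hc_class n x" by (auto simp: hecke_clifford_carrier)
    then show "\<exists>v'\<in>carrier (hecke_clifford n). v \<oplus>\<^bsub>hecke_clifford n\<^esub> v' = \<zero>\<^bsub>hecke_clifford n\<^esub>"
      by (intro bexI[of _ "hc_class n (- x)"]) (auto simp: hecke_clifford_carrier hecke_clifford_simps free_carrier)
  qed
qed (auto simp: hecke_clifford_carrier hecke_clifford_simps free_carrier algebra_simps scal_mult scal_add)

lemma hc_class_sum:
  assumes "finite S" "\<And>i. i \<in> S \<Longrightarrow> x i \<in> carrier (\<F> n)"
  shows "(\<Oplus>\<^bsub>hecke_clifford n\<^esub>i\<in>S. k i \<odot>\<^bsub>hecke_clifford n\<^esub> hc_class n (x i)) =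
    hc_class n (\<Sum>i\<in>S. scal (k i) * x i)"
  using assms
proof (induction S rule: finite_induct)
  interpret vectorspace class_ring "hecke_clifford n" by (rule vectorspace_hecke_clifford)
  case empty
  show ?case by (simp add: hecke_clifford_zero)
next
  interpret vectorspace class_ring "hecke_clifford n" by (rule vectorspace_hecke_clifford)
  case (insert i S)
  then have "(\<Oplus>\<^bsub>hecke_clifford n\<^esub>i\<in>insert i S. k i \<odot>\<^bsub>hecke_clifford n\<^esub> hc_class n (x i)) =
      k i \<odot>\<^bsub>hecke_clifford n\<^esub> hc_class n (x i) \<oplus>\<^bsub>hecke_clifford n\<^esub>
      (\<Oplus>\<^bsub>hecke_clifford n\<^esub>i\<in>S. k i \<odot>\<^bsub>hecke_clifford n\<^esub> hc_class n (x i))"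
    by (intro M.finsum_insert) (auto simp: hecke_clifford_carrier hecke_clifford_smult free_carrier)
  also have "\<dots> = hc_class n (scal (k i) * x i) \<oplus>\<^bsub>hecke_clifford n\<^esub> hc_class n (\<Sum>i\<in>S. scal (k i) * x i)"
    using insert by (simp add: hecke_clifford_smult)
  also have "\<dots> = hc_class n (scal (k i) * x i + (\<Sum>i\<in>S. scal (k i) * x i))"
    using insert.prems by (intro hecke_clifford_add) (auto intro!: free_carrier)
  finally show ?case using insert.hyps by simp
qed

text \<open>Linear independence in a vector space concerns sets, so a family needs injectivity in
  addition. A coincidence would be a relation with coefficients 1 and -1.\<close>

lemma CT_elem_inj: "inj_on (\<lambda>p. hc_class n (CT_elem n p)) (hc_index n)"
proof (rule inj_onI, rule ccontr)
  fix p r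
  assume p: "p \<in> hc_index n" and r: "r \<in> hc_index n" and pr: "p \<noteq> r"
    and "hc_class n (CT_elem n p) = hc_class n (CT_elem n r)"
  then have eq: "CT_elem n p - CT_elem n r \<in> hc_ideal n"
    by (simp add: hc_class_eq_iff CT_elem_carrier hc_eq_def)
  define k :: "_ \<Rightarrow> hc_field" where "k s = (if s = p then 1 else 0) - (if s = r then 1 else 0)" for s
  have single: "(\<Sum>s\<in>hc_index n. scal (if s = t then 1 else 0) * CT_elem n s) = CT_elem n t"
    if "t \<in> hc_index n" for t
  proof -
    have "(\<Sum>s\<in>hc_index n. scal (if s = t then 1 else 0) * CT_elem n s) =
        (\<Sum>s\<in>hc_index n. if s = t then CT_elem n s else 0)"
      by (intro sum.cong) auto
    then show ?thesis using that finite_hc_index by simp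
  qed
  have "(\<Sum>s\<in>hc_index n. scal (k s) * CT_elem n s) = CT_elem n p - CT_elem n r"
    by (simp only: k_def scal_diff left_diff_distrib sum_subtractf single[OF p] single[OF r])
  then have "k p = 0" using CT_elem_independent[of k n p] eq p by simp
  then show False using pr by (simp add: k_def)
qed

lemma TC_elem_basis:
  "inj_on (\<lambda>p. hc_class n (TC_elem n p)) (hc_index n)"
  "vectorspace.basis class_ring (hecke_clifford n) ((\<lambda>p. hc_class n (TC_elem n p)) ` hc_index n)"
proof -
  note * = basis_of_spanning_family[of "hecke_clifford n" "hc_index n" "\<lambda>p. hc_class n (TC_elem n p)"
      "\<lambda>p. hc_class n (CT_elem n p)", OF vectorspace_hecke_clifford finite_hc_index _ _ _ CT_elem_inj]
  have span: "\<exists>k. x = (\<Oplus>\<^bsub>hecke_clifford n\<^esub>p\<in>hc_index n. k p \<odot>\<^bsub>hecke_clifford n\<^esub> hc_class n (TC_elem n p))"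
    if x: "x \<in> carrier (hecke_clifford n)" for x
  proof -
    obtain y where y: "y \<in> carrier (\<F> n)" "x = hc_class n y" using x by (auto simp: hecke_clifford_carrier)
    obtain k where "hc_eq n y (\<Sum>p\<in>hc_index n. scal (k p) * TC_elem n p)"
      using TC_span_carrier[OF y(1)] by (auto simp: TC_span_def)
    then have "x = hc_class n (\<Sum>p\<in>hc_index n. scal (k p) * TC_elem n p)"
      using y by (simp add: hc_class_eq_iff free_carrier TC_elem_carrier)
    then have "x = (\<Oplus>\<^bsub>hecke_clifford n\<^esub>p\<in>hc_index n. k p \<odot>\<^bsub>hecke_clifford n\<^esub> hc_class n (TC_elem n p))"
      by (simp add: hc_class_sum finite_hc_index TC_elem_carrier)
    then show ?thesis by blast
  qed
  have indep: "k p = 0"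
    if "(\<Oplus>\<^bsub>hecke_clifford n\<^esub>p\<in>hc_index n. k p \<odot>\<^bsub>hecke_clifford n\<^esub> hc_class n (CT_elem n p)) = \<zero>\<^bsub>hecke_clifford n\<^esub>"
      "p \<in> hc_index n" for k p
  proof -
    have "hc_class n (\<Sum>p\<in>hc_index n. scal (k p) * CT_elem n p) = hc_class n 0"
      using that(1) by (simp add: hc_class_sum finite_hc_index CT_elem_carrier hecke_clifford_zero)
    then have "(\<Sum>p\<in>hc_index n. scal (k p) * CT_elem n p) \<in> hc_ideal n"
      by (simp add: hc_class_eq_iff free_carrier CT_elem_carrier hc_eq_def)
    then show ?thesis by (rule CT_elem_independent[OF _ that(2)])
  qed
  have car: "hc_class n (TC_elem n p) \<in> carrier (hecke_clifford n)"
    "hc_class n (CT_elem n p) \<in> carrier (hecke_clifford n)" for p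
    by (auto simp: hecke_clifford_carrier TC_elem_carrier CT_elem_carrier)
  show "inj_on (\<lambda>p. hc_class n (TC_elem n p)) (hc_index n)"
    by (rule *(1)) (rule car | erule span | erule (1) indep)+
  show "vectorspace.basis class_ring (hecke_clifford n) ((\<lambda>p. hc_class n (TC_elem n p)) ` hc_index n)"
    by (rule *(2)) (rule car | erule span | erule (1) indep)+
qed

lemma operator_trace_T_word:
  assumes w: "set w \<subseteq> {1..<n}" "distinct w"
  shows "operator_trace (hecke_clifford n) (\<lambda>x. hc_class n (T_word w) \<otimes>\<^bsub>hecke_clifford n\<^esub> x) =
    2 ^ n * (q - 1) ^ length w * of_nat (card {f. f permutes {1..n} \<and> (\<forall>i\<in>set w. f (Suc i) < f i)})"
proof -
  let ?A = "hecke_clifford n"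
  note wC = T_word_carrier[OF w(1)]
  let ?f = "\<lambda>x. hc_class n (T_word w) \<otimes>\<^bsub>?A\<^esub> x"
  let ?D = "\<lambda>f. \<forall>i\<in>set w. f (Suc i) < (f i :: nat)"
  have "\<forall>p\<in>hc_index n. \<exists>M. hc_eq n (T_word w * TC_elem n p) (\<Sum>r\<in>hc_index n. scal (M r) * TC_elem n r) \<and>
      M p = (if ?D (fst p) then (q - 1) ^ length w else 0)"
    using T_word_TC_elem[OF w] by blast
  from bchoice[OF this] obtain M where
    "\<forall>p\<in>hc_index n. hc_eq n (T_word w * TC_elem n p) (\<Sum>r\<in>hc_index n. scal (M p r) * TC_elem n r) \<and>
      M p p = (if ?D (fst p) then (q - 1) ^ length w else 0)"
    by blast
  then have M: "hc_eq n (T_word w * TC_elem n p) (\<Sum>r\<in>hc_index n. scal (M p r) * TC_elem n r)"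
    and diag: "M p p = (if ?D (fst p) then (q - 1) ^ length w else 0)" if "p \<in> hc_index n" for p
    using that by blast+
  have "linear_endo ?A ?f"
    using wC by (auto simp: linear_endo_def hecke_clifford_carrier hecke_clifford_simps free_carrier
        distrib_left scal_left_central)
  then have "operator_trace ?A ?f = (\<Sum>p\<in>hc_index n. M p p)"
  proof (rule operator_trace_family[where M = M, OF vectorspace_hecke_clifford _ finite_hc_index TC_elem_basis])
    fix p assume "p \<in> hc_index n"
    from M[OF this] show "?f (hc_class n (TC_elem n p)) =
        (\<Oplus>\<^bsub>?A\<^esub>r\<in>hc_index n. M p r \<odot>\<^bsub>?A\<^esub> hc_class n (TC_elem n r))"
      using wC by (simp add: hc_class_sum finite_hc_index TC_elem_carrier hecke_clifford_mult
          hc_class_eq_iff free_carrier)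
  qed
  \<comment> \<open>The diagonal coefficient does not depend on \<open>I\<close>; the subsets
    account for the factor \<open>2 ^ n\<close>.\<close>
  also have "\<dots> = (\<Sum>f | f permutes {1..n}. \<Sum>I\<in>Pow {1..n}. if ?D f then (q - 1) ^ length w else 0)"
    unfolding sum.cartesian_product hc_index_def[symmetric] by (intro sum.cong) (auto simp: diag)
  also have "\<dots> = 2 ^ n * (\<Sum>f | f permutes {1..n}. if ?D f then (q - 1) ^ length w else 0)"
    by (simp add: card_Pow sum_distrib_left)
  also have "(\<Sum>f | f permutes {1..n}. if ?D f then (q - 1) ^ length w else 0) =
      (\<Sum>f | f permutes {1..n} \<and> ?D f. (q - 1) ^ length w)"
    using finite_permutes by (simp add: sum.inter_filter[symmetric])
  finally show ?thesis by (simp add: mult.assoc mult.commute)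
qed

lemma foldr_hc_T:
  "set w \<subseteq> {1..<n} \<Longrightarrow>
    foldr (\<lambda>i x. hc_T n i \<otimes>\<^bsub>hecke_clifford n\<^esub> x) w \<one>\<^bsub>hecke_clifford n\<^esub> = hc_class n (T_word w)"
proof (induction w)
  case Nil
  show ?case by (simp add: hecke_clifford_one)
next
  case (Cons i w)
  have "hc_T n i = hc_class n (free_T i)" by (simp add: hc_T_def hc_class_def)
  with Cons show ?case
    by (simp add: hecke_clifford_mult T_word_carrier carrier_T)
qed

section \<open>Reduced words and counting\<close>

text \<open>The letters are the positions below \<open>sum_list \<mu>\<close> that do not end a
  block.\<close>

fun gamma_word :: "nat list \<Rightarrow> nat list" where
  "gamma_word [] = []"
| "gamma_word (k # \<mu>) = [1..<k] @ map ((+) k) (gamma_word \<mu>)"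

lemma set_gamma_word: "set (gamma_word \<mu>) \<subseteq> {1..<sum_list \<mu>}"
  by (induction \<mu>) fastforce+

lemma distinct_gamma_word: "distinct (gamma_word \<mu>)"
  by (induction \<mu>) (auto simp: distinct_map inj_on_def)

lemma length_gamma_word: "\<forall>k\<in>set \<mu>. k > 0 \<Longrightarrow> length (gamma_word \<mu>) + length \<mu> = sum_list \<mu>"
  by (induction \<mu>) auto

lemma word_perm_simps [simp]:
  "word_perm [] = id" "word_perm (i # w) = swap i \<circ> word_perm w"
  by (simp_all add: word_perm_def)

lemma word_perm_append: "word_perm (u @ v) = word_perm u \<circ> word_perm v"
  by (induction u) (auto simp: comp_assoc)

text \<open>The letter 0 must be excluded: shifted by \<open>k\<close> it would move position
  \<open>k\<close>, which \<open>shift_perm k\<close> fixes.\<close>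

lemma word_perm_shift:
  assumes "0 \<notin> set w"
  shows "word_perm (map ((+) k) w) = shift_perm k (word_perm w)"
  using assms
proof (induction w)
  case Nil
  show ?case by (auto simp: shift_perm_def fun_eq_iff)
next
  case (Cons i w)
  then show ?case by (auto simp: shift_perm_def fun_eq_iff transpose_def)
qed

lemma word_perm_gamma_word: "word_perm (gamma_word \<mu>) = gamma_perm \<mu>"
proof (induction \<mu>)
  case (Cons k \<mu>)
  have "0 \<notin> set (gamma_word \<mu>)" using set_gamma_word[of \<mu>] by auto
  then show ?case
    using Cons by (simp add: word_perm_append word_perm_shift coxeter_perm_def)
qed simp

lemma word_perm_image_atMost: "i \<notin> set w \<Longrightarrow> word_perm w ` {..i} = {..i}"
proof (induction w)
  case (Cons j w)
  then have "j \<noteq> i" "word_perm w ` {..i} = {..i}" by auto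
  with swap_image_atMost[of j i] have "word_perm w ` {..i} = {..i}" "swap j ` {..i} = {..i}"
    by blast+
  then show ?case by (simp only: word_perm_simps image_comp[symmetric])
qed simp

text \<open>The single occurrence of \<open>i\<close> moves \<open>{..i}\<close>; the letters before
  and after it cannot undo this.\<close>

lemma word_perm_image_atMost_distinct:
  assumes "distinct w" "i \<in> set w"
  shows "word_perm w ` {..i} \<noteq> {..i}"
proof -
  obtain u v where w: "w = u @ i # v" using assms(2) by (auto simp: in_set_conv_decomp)
  have "i \<notin> set u" "i \<notin> set v" using assms(1) w by auto
  note u = word_perm_image_atMost[OF this(1)] and v = word_perm_image_atMost[OF this(2)]
  have "inj (swap j)" for j by (rule inj_on_inverseI[of _ "swap j"]) simp
  then have "inj (word_perm u)"
    by (induction u) (simp_all only: word_perm_simps inj_on_id inj_compose)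
  have "word_perm w ` {..i} = word_perm u ` swap i ` {..i}"
    by (simp only: w word_perm_append word_perm_simps image_comp[symmetric] v)
  also have "\<dots> \<noteq> word_perm u ` {..i}"
    using swap_image_atMost_self by (simp only: inj_image_eq_iff[OF \<open>inj (word_perm u)\<close>] not_False_eq_True)
  finally show ?thesis using u by simp
qed

text \<open>A word for \<open>\<gamma>\<^sub>\<mu>\<close> must use every letter of \<open>gamma_word \<mu>\<close>, because without the letter \<open>i\<close> it would
  preserve \<open>{..i}\<close>. Hence a reduced word is a rearrangement of these letters.\<close>

lemma reduced_words_gamma_perm:
  assumes n: "n = sum_list \<mu>" and w: "w \<in> reduced_words n (gamma_perm \<mu>)"
  shows "set w = set (gamma_word \<mu>)" "distinct w" "length w = length (gamma_word \<mu>)"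
proof -
  have perm: "word_perm w = gamma_perm \<mu>" and le: "length w \<le> length (gamma_word \<mu>)"
    using w word_perm_gamma_word[of \<mu>] set_gamma_word[of \<mu>] n by (auto simp: reduced_words_def)
  have sub: "set (gamma_word \<mu>) \<subseteq> set w"
  proof
    fix i assume i: "i \<in> set (gamma_word \<mu>)"
    show "i \<in> set w"
      using word_perm_image_atMost_distinct[OF distinct_gamma_word i] word_perm_image_atMost[of i w]
      by (auto simp: word_perm_gamma_word perm)
  qed
  \<comment> \<open>Together with \<open>card (set w) \<le> length w\<close> and minimality this
    closes a chain of inequalities, so all of them are equalities.\<close>
  have "length (gamma_word \<mu>) = card (set (gamma_word \<mu>))"
    by (simp add: distinct_card[OF distinct_gamma_word])
  also have "\<dots> \<le> card (set w)" using sub by (simp add: card_mono)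
  finally have ge: "length (gamma_word \<mu>) \<le> card (set w)" .
  then show "length w = length (gamma_word \<mu>)" using le card_length[of w] by linarith
  then show "distinct w" using ge card_length[of w] by (intro card_distinct) linarith
  show "set w = set (gamma_word \<mu>)"
  proof (rule card_subset_eq[OF _ sub, symmetric])
    show "card (set (gamma_word \<mu>)) = card (set w)"
      using ge le card_length[of w] \<open>length (gamma_word \<mu>) = card (set (gamma_word \<mu>))\<close> by linarith
  qed simp
qed

lemma reduced_words_gamma_perm_nonempty:
  assumes "n = sum_list \<mu>"
  shows "reduced_words n (gamma_perm \<mu>) \<noteq> {}"
proof -
  let ?P = "\<lambda>w. set w \<subseteq> {1..<n} \<and> word_perm w = gamma_perm \<mu>"
  have "?P (gamma_word \<mu>)" using set_gamma_word[of \<mu>] word_perm_gamma_word[of \<mu>] assms by simp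
  from ex_has_least_nat[of ?P, OF this, of length] show ?thesis
    by (auto simp: reduced_words_def)
qed

text \<open>Positions in lists start at \<open>0\<close>, so \<open>xs ! i < xs ! (i - 1)\<close> is a descent at \<open>i\<close>.\<close>

definition block_desc :: "nat list \<Rightarrow> nat set \<Rightarrow> nat list set" where
  "block_desc \<mu> S = {xs. distinct xs \<and> set xs = S \<and> (\<forall>i\<in>set (gamma_word \<mu>). xs ! i < xs ! (i - 1))}"

text \<open>The first block is decreasing, hence determined by its set \<open>Y\<close> of entries.
  No condition links it to the next block, so the rest is an arbitrary list of the same kind on
  \<open>S - Y\<close>.\<close>

lemma block_desc_Cons:
  assumes "finite S" "card S = k + sum_list \<mu>"
  shows "bij_betw (\<lambda>(Y, zs). rev (sorted_list_of_set Y) @ zs)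
    (SIGMA Y : {Y. Y \<subseteq> S \<and> card Y = k}. block_desc \<mu> (S - Y)) (block_desc (k # \<mu>) S)"
proof (rule bij_betw_byWitness[where f' = "\<lambda>xs. (set (take k xs), drop k xs)"])
  have len: "length (sorted_list_of_set Y) = k" if "Y \<subseteq> S" "card Y = k" for Y :: "nat set"
    using that assms(1) by simp
  have fin: "finite Y" if "Y \<subseteq> S" for Y using that assms(1) finite_subset by blast
  have tail: "(\<forall>i\<in>set (map ((+) k) (gamma_word \<mu>)). (ys @ zs) ! i < (ys @ zs) ! (i - 1)) \<longleftrightarrow>
      (\<forall>i\<in>set (gamma_word \<mu>). zs ! i < zs ! (i - 1))" if "length ys = k" for ys zs :: "nat list"
  proof -
    have "(ys @ zs) ! (k + i) = zs ! i \<and> (ys @ zs) ! (k + i - 1) = zs ! (i - 1)" if "i \<in> set (gamma_word \<mu>)" for i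
    proof -
      \<comment> \<open>Ensures that the truncated subtraction in \<open>i - 1\<close> does not
        leave the second part of the list.\<close>
      have "1 \<le> i" using that set_gamma_word[of \<mu>] by auto
      then have "k + i - 1 = k + (i - 1)" by simp
      moreover have "(ys @ zs) ! (k + j) = zs ! j" for j
        using nth_append_length_plus[of ys zs j] unfolding \<open>length ys = k\<close> .
      ultimately show ?thesis by (simp only:)
    qed
    then show ?thesis by simp
  qed
  have head: "(\<forall>i\<in>set [1..<k]. (ys @ zs) ! i < (ys @ zs) ! (i - 1)) \<longleftrightarrow> sorted_wrt (>) ys"
    if "length ys = k" for ys zs :: "nat list"
  proof -
    have "sorted_wrt (>) ys \<longleftrightarrow> (\<forall>i. Suc i < k \<longrightarrow> ys ! Suc i < ys ! i)"
      using that by (simp add: sorted_wrt_iff_nth_Suc_transp transp_on_def)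
    also have "\<dots> \<longleftrightarrow> (\<forall>i\<in>set [1..<k]. (ys @ zs) ! i < (ys @ zs) ! (i - 1))"
    proof
      assume *: "\<forall>i. Suc i < k \<longrightarrow> ys ! Suc i < ys ! i"
      show "\<forall>i\<in>set [1..<k]. (ys @ zs) ! i < (ys @ zs) ! (i - 1)"
      proof
        fix i assume "i \<in> set [1..<k]"
        then show "(ys @ zs) ! i < (ys @ zs) ! (i - 1)"
          using *[rule_format, of "i - 1"] that by (auto simp: nth_append)
      qed
    next
      assume *: "\<forall>i\<in>set [1..<k]. (ys @ zs) ! i < (ys @ zs) ! (i - 1)"
      show "\<forall>i. Suc i < k \<longrightarrow> ys ! Suc i < ys ! i"
      proof (intro allI impI)
        fix i assume "Suc i < k"
        then show "ys ! Suc i < ys ! i"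
          using *[rule_format, of "Suc i"] that by (simp add: nth_append)
      qed
    qed
    finally show ?thesis by simp
  qed
  have mem: "ys @ zs \<in> block_desc (k # \<mu>) S \<longleftrightarrow>
      distinct (ys @ zs) \<and> set ys \<union> set zs = S \<and> sorted_wrt (>) ys \<and>
      (\<forall>i\<in>set (gamma_word \<mu>). zs ! i < zs ! (i - 1))" if "length ys = k" for ys zs
    using head[OF that, of zs] tail[OF that, of zs] by (auto simp: block_desc_def)
  have split: "\<exists>ys zs. xs = ys @ zs \<and> length ys = k" if "xs \<in> block_desc (k # \<mu>) S" for xs
  proof (intro exI conjI)
    show "xs = take k xs @ drop k xs" by simp
    have "length xs = card S" using that distinct_card[of xs] by (auto simp: block_desc_def)
    then show "length (take k xs) = k" using assms(2) by simp
  qed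
  have sorted: "sorted_wrt (>) ys \<Longrightarrow> rev (sorted_list_of_set (set ys)) = ys" for ys :: "nat list"
  proof -
    assume "sorted_wrt (>) ys"
    then have "sorted_wrt (<) (rev ys)" by (simp add: sorted_wrt_rev)
    from strict_sorted_equal[OF this, of "sorted_list_of_set (set ys)"]
    show ?thesis by (simp add: rev_swap)
  qed
  show "\<forall>p\<in>SIGMA Y : {Y. Y \<subseteq> S \<and> card Y = k}. block_desc \<mu> (S - Y).
      (\<lambda>xs. (set (take k xs), drop k xs)) ((\<lambda>(Y, zs). rev (sorted_list_of_set Y) @ zs) p) = p"
    using len fin by auto
  show "\<forall>xs\<in>block_desc (k # \<mu>) S.
      (\<lambda>(Y, zs). rev (sorted_list_of_set Y) @ zs) ((\<lambda>xs. (set (take k xs), drop k xs)) xs) = xs"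
  proof
    fix xs assume xs: "xs \<in> block_desc (k # \<mu>) S"
    obtain ys zs where ys: "xs = ys @ zs" "length ys = k" using split[OF xs] by blast
    then show "(\<lambda>(Y, zs). rev (sorted_list_of_set Y) @ zs) ((\<lambda>xs. (set (take k xs), drop k xs)) xs) = xs"
      using mem[OF ys(2), of zs] xs sorted[of ys] by simp
  qed
  show "(\<lambda>(Y, zs). rev (sorted_list_of_set Y) @ zs) `
      (SIGMA Y : {Y. Y \<subseteq> S \<and> card Y = k}. block_desc \<mu> (S - Y)) \<subseteq> block_desc (k # \<mu>) S"
  proof (clarify)
    fix Y zs assume Y: "Y \<subseteq> S" "k = card Y" and zs: "zs \<in> block_desc \<mu> (S - Y)"
    have "length (rev (sorted_list_of_set Y)) = k" using len[of Y] Y by simp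
    then show "rev (sorted_list_of_set Y) @ zs \<in> block_desc (card Y # \<mu>) S"
      using mem[of "rev (sorted_list_of_set Y)" zs] Y zs fin[OF Y(1)]
      by (auto simp: block_desc_def sorted_wrt_rev)
  qed
  show "(\<lambda>xs. (set (take k xs), drop k xs)) ` block_desc (k # \<mu>) S \<subseteq>
      (SIGMA Y : {Y. Y \<subseteq> S \<and> card Y = k}. block_desc \<mu> (S - Y))"
  proof (rule image_subsetI)
    fix xs assume xs: "xs \<in> block_desc (k # \<mu>) S"
    obtain ys zs where ys: "xs = ys @ zs" "length ys = k" using split[OF xs] by blast
    have *: "distinct ys" "distinct zs" "set ys \<inter> set zs = {}" "set ys \<union> set zs = S"
      "\<forall>i\<in>set (gamma_word \<mu>). zs ! i < zs ! (i - 1)"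
      using mem[OF ys(2), of zs] xs ys(1) by auto
    have 1: "set (take k xs) \<subseteq> S" "card (set (take k xs)) = k"
      using * ys by (auto simp: distinct_card)
    have "S - set ys = set zs" using * by auto
    then have "drop k xs \<in> block_desc \<mu> (S - set (take k xs))"
      using * ys by (simp add: block_desc_def)
    with 1 show "(set (take k xs), drop k xs) \<in> (SIGMA Y : {Y. Y \<subseteq> S \<and> card Y = k}. block_desc \<mu> (S - Y))"
      by simp
  qed
qed

text \<open>The multinomial recursion: a binomial coefficient for the entries of the first block
  times the count for the remaining ones. The product form avoids division on natural
  numbers.\<close>

lemma card_block_desc:
  assumes "finite S" "card S = sum_list \<mu>"
  shows "card (block_desc \<mu> S) * (\<Prod>k\<leftarrow>\<mu>. fact k) = fact (card S)"
  using assms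
proof (induction \<mu> arbitrary: S)
  case Nil
  then have "block_desc [] S = {[]}" by (auto simp: block_desc_def)
  with Nil show ?case by simp
next
  case (Cons k \<mu>)
  let ?Y = "{Y. Y \<subseteq> S \<and> card Y = k}"
  let ?p = "\<Prod>k\<leftarrow>\<mu>. fact k :: nat"
  have fin: "finite ?Y" using Cons.prems(1) by simp
  have Y: "card (block_desc \<mu> (S - Y)) * ?p = fact (card S - k)" if "Y \<in> ?Y" for Y
  proof -
    have "card (S - Y) = card S - k" using that Cons.prems by (auto simp: card_Diff_subset finite_subset)
    then show ?thesis using Cons.IH[of "S - Y"] Cons.prems by simp
  qed
  have fb: "finite (block_desc \<mu> (S - Y))" for Y
  proof (rule finite_subset)
    show "block_desc \<mu> (S - Y) \<subseteq> {xs. set xs \<subseteq> S \<and> length xs \<le> card S}"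
      using Cons.prems(1) by (auto simp: block_desc_def distinct_card[symmetric] intro: card_mono)
    show "finite {xs. set xs \<subseteq> S \<and> length xs \<le> card S}"
      by (rule finite_lists_length_le[OF Cons.prems(1)])
  qed
  have "card (block_desc (k # \<mu>) S) = card (SIGMA Y : ?Y. block_desc \<mu> (S - Y))"
    using bij_betw_same_card[OF block_desc_Cons[of S k \<mu>]] Cons.prems by simp
  also have "\<dots> = (\<Sum>Y\<in>?Y. card (block_desc \<mu> (S - Y)))"
    using fin fb by (simp add: card_SigmaI)
  finally have "card (block_desc (k # \<mu>) S) * ?p = (\<Sum>Y\<in>?Y. card (block_desc \<mu> (S - Y)) * ?p)"
    by (simp add: sum_distrib_right)
  also have "\<dots> = (card S choose k) * fact (card S - k)"
    using Y n_subsets[OF Cons.prems(1), of k] by simp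
  finally have "card (block_desc (k # \<mu>) S) * (\<Prod>k\<leftarrow>k # \<mu>. fact k) =
      fact k * fact (card S - k) * (card S choose k)"
    by (simp add: mult_ac)
  also have "\<dots> = fact (card S)"
    using binomial_fact_lemma[of k "card S"] Cons.prems(2) by simp
  finally show ?case .
qed

text \<open>A permutation of \<open>{1..n}\<close> is identified with its list of values; the index
  shift by one matches the convention of \<open>block_desc\<close>.\<close>

lemma card_descent_permutations:
  assumes n: "n = sum_list \<mu>"
  shows "card {f. f permutes {1..n} \<and> (\<forall>i\<in>set (gamma_word \<mu>). f (Suc i) < f i)} * (\<Prod>k\<leftarrow>\<mu>. fact k) = fact n"
proof -
  let ?F = "{f. f permutes {1..n} \<and> (\<forall>i\<in>set (gamma_word \<mu>). f (Suc i) < f i)}"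
  have nth: "map f [1..<Suc n] ! i = f (Suc i)" if "i < n" for f :: "nat \<Rightarrow> nat" and i
    using that by (simp add: nth_append)
  have desc: "(\<forall>i\<in>set (gamma_word \<mu>). map f [1..<Suc n] ! i < map f [1..<Suc n] ! (i - 1)) \<longleftrightarrow>
      (\<forall>i\<in>set (gamma_word \<mu>). f (Suc i) < f i)" for f :: "nat \<Rightarrow> nat"
  proof (rule ball_cong[OF refl])
    fix i assume "i \<in> set (gamma_word \<mu>)"
    then have "1 \<le> i" "i < n" using set_gamma_word[of \<mu>] n by auto
    then show "(map f [1..<Suc n] ! i < map f [1..<Suc n] ! (i - 1)) = (f (Suc i) < f i)"
      using nth[of i f] nth[of "i - 1" f] by simp
  qed
  have set: "set [1..<Suc n] = {1..n}" by auto
  have "bij_betw (\<lambda>f. map f [1..<Suc n]) ?F (block_desc \<mu> {1..n})"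
    unfolding bij_betw_def
  proof
    show "inj_on (\<lambda>f. map f [1..<Suc n]) ?F"
    proof (rule inj_onI, rule ext)
      fix f g x assume fg: "f \<in> ?F" "g \<in> ?F" and eq: "map f [1..<Suc n] = map g [1..<Suc n]"
      have "\<forall>x\<in>{1..n}. f x = g x" using eq unfolding map_eq_conv set .
      moreover have "f x = x" "g x = x" if "x \<notin> {1..n}"
        using fg that by (auto simp: permutes_def)
      ultimately show "f x = g x" by (cases "x \<in> {1..n}") auto
    qed
    show "(\<lambda>f. map f [1..<Suc n]) ` ?F = block_desc \<mu> {1..n}"
    proof (intro equalityI subsetI)
      fix xs assume "xs \<in> (\<lambda>f. map f [1..<Suc n]) ` ?F"
      then obtain f where f: "f \<in> ?F" "xs = map f [1..<Suc n]" by blast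
      then have perm: "f permutes {1..n}" by blast
      have "distinct xs"
        unfolding f(2) distinct_map set using permutes_inj_on[OF perm] by simp
      moreover have "set xs = {1..n}"
        unfolding f(2) set_map set by (rule permutes_image[OF perm])
      ultimately show "xs \<in> block_desc \<mu> {1..n}"
        using f desc[of f] unfolding block_desc_def by blast
    next
      fix xs assume xs: "xs \<in> block_desc \<mu> {1..n}"
      then have d: "distinct xs" "set xs = {1..n}" by (auto simp: block_desc_def)
      then have len: "length xs = n" using distinct_card[of xs] by simp
      define f where "f i = (if i \<in> {1..n} then xs ! (i - 1) else i)" for i
      have map: "map f [1..<Suc n] = xs"
        using len nth[of _ f] by (intro nth_equalityI) (auto simp: f_def)
      have "bij_betw f {1..n} {1..n}"
        unfolding bij_betw_def
      proof
        have "distinct (map f [1..<Suc n])" unfolding map by (rule d)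
        then show "inj_on f {1..n}" unfolding distinct_map set by blast
        have "set (map f [1..<Suc n]) = {1..n}" unfolding map by (rule d)
        then show "f ` {1..n} = {1..n}" unfolding set_map set .
      qed
      then have "f permutes {1..n}" by (rule bij_imp_permutes) (auto simp: f_def)
      moreover have "\<forall>i\<in>set (gamma_word \<mu>). f (Suc i) < f i"
        using xs desc[of f] unfolding map by (auto simp: block_desc_def)
      ultimately show "xs \<in> (\<lambda>f. map f [1..<Suc n]) ` ?F" using map by (intro image_eqI[of _ _ f]) auto
    qed
  qed
  from bij_betw_same_card[OF this] card_block_desc[of "{1..n}" \<mu>] n show ?thesis by simp
qed

text \<open>Characteristic zero, needed to divide by the product of factorials in the ground
  field.\<close>

lemma of_nat_hc_field_eq_0_iff: "of_nat m = (0 :: hc_field) \<longleftrightarrow> m = 0"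
proof -
  have "of_nat m = (Fract (of_nat m) 1 :: hc_field)" by (simp add: Fract_of_nat_eq)
  then show ?thesis by (simp add: Zero_fract_def eq_fract)
qed

theorem corollary4p6:
  fixes n :: nat and \<mu> :: "nat list"
  assumes "is_partition n \<mu>"
    and "\<forall>k \<in> set \<mu>. odd k"
  shows "zeta_reg n \<mu> =
    2 ^ n * (q - 1) ^ (n - length \<mu>) * (of_nat (fact n) / of_nat (\<Prod>k\<leftarrow>\<mu>. fact k))"
proof -
  have n: "n = sum_list \<mu>" and pos: "\<forall>k\<in>set \<mu>. k > 0"
    using assms(1) by (auto simp: is_partition_def)
  \<comment> \<open>Exactly the reduced word that \<open>hc_T_perm\<close> picks.\<close>
  define w where "w = (SOME w. w \<in> reduced_words n (gamma_perm \<mu>))"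
  have red: "w \<in> reduced_words n (gamma_perm \<mu>)"
    unfolding w_def using reduced_words_gamma_perm_nonempty[OF n] by (simp add: some_in_eq)
  note w = reduced_words_gamma_perm[OF n red]
  have letters: "set w \<subseteq> {1..<n}" using red by (simp add: reduced_words_def)
  have len: "length w = n - length \<mu>" using w(3) length_gamma_word[OF pos] n by simp
  let ?c = "card {f. f permutes {1..n} \<and> (\<forall>i\<in>set w. f (Suc i) < f i)}"
  let ?p = "\<Prod>k\<leftarrow>\<mu>. fact k :: nat"
  have "hc_T_perm n (gamma_perm \<mu>) = hc_class n (T_word w)"
    unfolding hc_T_perm_def w_def[symmetric] by (rule foldr_hc_T[OF letters])
  then have zeta: "zeta_reg n \<mu> = 2 ^ n * (q - 1) ^ (n - length \<mu>) * of_nat ?c"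
    by (simp add: zeta_reg_def operator_trace_T_word[OF letters w(2)] len)
  have "?c * ?p = fact n"
    using card_descent_permutations[OF n] w(1) by simp
  then have "of_nat (?c * ?p) = (of_nat (fact n) :: hc_field)" by (rule arg_cong)
  then have "of_nat ?c * of_nat ?p = (of_nat (fact n) :: hc_field)" unfolding of_nat_mult .
  moreover have "of_nat ?p \<noteq> (0 :: hc_field)"
    unfolding of_nat_hc_field_eq_0_iff by (auto simp: prod_list_zero_iff)
  ultimately have "of_nat ?c = (of_nat (fact n) / of_nat ?p :: hc_field)"
    by (simp only: nonzero_eq_divide_eq not_False_eq_True)
  with zeta show ?thesis by (simp only:)
qed

end
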